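(* The graph Jones polynomial is invariant under graph-theoretic Reidemeister equivalence: if $G$ and $G'$ are Reidemeister equivalent graphs, then $V_G(t)=V_{G'}(t)$.
   Context: Graphs are finite, undirected, may have loops (at most one per vertex), and have no multiple edges; the empty graph is allowed. For a graph $G$ with $V(G)=\{v_1,\dots,v_n\}$, the Boolean adjacency matrix $\mathcal{A}(G)=(a_{ij})$ is the $n\times n$ matrix over $GF(2)$ with $a_{ij}=1$ if and only if $\{v_i,v_j\}$ is an edge of $G$ (so $a_{ii}=1$ if and only if there is a loop at $v_i$). The graph bracket polynomial of $G$ is $$[G](A,B,d)=\sum_{\Delta}A^{\nu(\Delta)}B^{\rho(\Delta)}d^{\,\nu(\mathcal{A}(G)+\Delta)},$$ the sum being over all $n\times n$ diagonal matrices $\Delta$ over $GF(2)$, where $\nu$ and $\rho$ denote nullity and rank over $GF(2)$. The reduced graph bracket is the Laurent polynomial $\langle G\rangle(A)=[G](A,A^{-1},-A^{2}-A^{-2})$. If $G$ has $n$ vertices and $\ell$ loops, the graph Jones polynomial is $V_G(t)=(-1)^n\, t^{(3n-6\ell)/4}\,\langle G\rangle(t^{-1/4})$ (a Laurent polynomial in $t^{1/4}$). Two graphs are Reidemeister equivalent if one can be obtained from the other (up to isomorphism) by a finite sequence of the following moves. $\Omega.1$: adjoin or remove an isolated vertex (i.e. a vertex not adjacent to any other vertex), which may be looped or unlooped. $\Omega.2$: adjoin or remove two vertices $v$ and $w$ such that (i) $v$ is looped, (ii) $w$ is not looped, and (iii) every vertex $x\notin\{v,w\}$ that is adjacent to one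 of $v,w$ is also adjacent to the other. The vertices $v$ and $w$ may be adjacent or nonadjacent. $\Omega.3$: toggle (insert if absent, remove if present) all three non-loop adjacencies among three distinct vertices $u,v,w$, provided that (i) every vertex $x\notin\{u,v,w\}$ that is adjacent to any of $u,v,w$ is adjacent to precisely two of $u,v,w$, and (ii) either the initial or the terminal subgraph spanned by $u,v,w$ (including loops) is isomorphic to one of these six three-vertex graphs: (1) the three-vertex path with all three vertices looped; (2) the three-vertex path with no loops; (3) the three-vertex path with loops at the middle vertex and at exactly one end vertex; (4) the three-vertex path with a loop at exactly one end vertex and no other loops; (5) the triangle with loops at exactly two vertices; (6) the triangle with a loop at exactly one vertex. *)

theory Defs
  imports
    "Jordan_Normal_Form.DL_Rank"
    "Jordan_Normal_Form.Matrix_Kernel"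
    "Graph_Theory.Pair_Digraph"
    "Graph_Theory.Digraph_Isomorphism"
    "HOL-Library.Z2"
    "HOL-Library.Poly_Mapping"
begin

text \<open>
  Finite undirected graphs with loops but without multiple edges are the structures satisfying
  \<^locale>\<open>pair_pseudo_graph\<close>: an edge between distinct vertices \<open>x\<close>, \<open>y\<close> is the pair of arcs
  \<open>(x, y)\<close>, \<open>(y, x)\<close>, and a loop at \<open>x\<close> is the single arc \<open>(x, x)\<close>.
  For such graphs \<^const>\<open>digraph_iso\<close> is ordinary graph isomorphism, since the action on arcs is
  determined by the action on vertices.
\<close>

definition vertex_list :: "'a pair_pre_digraph \<Rightarrow> 'a list" where
  "vertex_list G = (SOME vs. distinct vs \<and> set vs = pverts G)"

lemma vertex_list:
  assumes "pair_pseudo_graph G"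
  shows "distinct (vertex_list G)" "set (vertex_list G) = pverts G"
proof -
  have "finite (pverts G)"
    using assms by (simp add: pair_pseudo_graph_def pair_fin_digraph_def pair_fin_digraph_axioms_def)
  then have "\<exists>vs. distinct vs \<and> set vs = pverts G"
    using finite_distinct_list by blast
  from someI_ex[OF this] show "distinct (vertex_list G)" "set (vertex_list G) = pverts G"
    by (simp_all add: vertex_list_def)
qed

definition adjacency_matrix :: "'a pair_pre_digraph \<Rightarrow> bit mat" where
  "adjacency_matrix G =
     (let vs = vertex_list G; n = length vs
      in mat n n (\<lambda>(i, j). of_bool ((vs ! i, vs ! j) \<in> parcs G)))"

text \<open>
  The three-variable bracket has integer coefficients; it is given by its values at all triples of
  elements of a commutative ring.
\<close>

definition graph_bracket :: "'a pair_pre_digraph \<Rightarrow> 'r \<Rightarrow> 'r \<Rightarrow> 'r \<Rightarrow> 'r::comm_ring_1" where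
  "graph_bracket G A B d =
     (let n = card (pverts G)
      in \<Sum>D | D \<in> carrier_mat n n \<and> diagonal_mat D.
           A ^ kernel_dim D * B ^ vec_space.rank n D * d ^ kernel_dim (adjacency_matrix G + D))"

text \<open>
  Integral Laurent polynomials in one variable are the finitely supported functions from exponents
  to coefficients, i.e. the group ring of the additive group of integers, whose multiplication is
  that of \<^type>\<open>poly_mapping\<close>.
\<close>

type_synonym laurent = "int \<Rightarrow>\<^sub>0 int"

definition reduced_bracket :: "'a pair_pre_digraph \<Rightarrow> laurent" where
  "reduced_bracket G =
     (let A = Poly_Mapping.single 1 1; A' = Poly_Mapping.single (-1) 1
      in graph_bracket G A A' (- A\<^sup>2 - A'\<^sup>2))"

text \<open>
  The Jones polynomial is a Laurent polynomial in \<open>t\<close> to the power \<open>1/4\<close>: the exponent \<open>k\<close> stands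
  for \<open>t\<close> to the power \<open>k/4\<close>. Thus substituting \<open>t\<close> to the power \<open>-1/4\<close> for \<open>A\<close> in a Laurent
  polynomial in \<open>A\<close> negates all exponents.
\<close>

definition jones_polynomial :: "'a pair_pre_digraph \<Rightarrow> laurent" where
  "jones_polynomial G =
     (let n = card (pverts G); l = card {v \<in> pverts G. (v, v) \<in> parcs G}
      in (-1) ^ n * Poly_Mapping.single (3 * int n - 6 * int l) 1
           * Poly_Mapping.map_key uminus (reduced_bracket G))"

text \<open>The first two moves are oriented so that vertices are removed in passing from \<open>G\<close> to \<open>H\<close>.\<close>

definition omega1 :: "'a pair_pre_digraph \<Rightarrow> 'a pair_pre_digraph \<Rightarrow> bool" where
  "omega1 G H \<longleftrightarrow> (\<exists>v \<in> pverts G.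
     (\<forall>x \<in> pverts G - {v}. (x, v) \<notin> parcs G) \<and>
     with_proj H = with_proj G \<restriction> (pverts G - {v}))"

definition omega2 :: "'a pair_pre_digraph \<Rightarrow> 'a pair_pre_digraph \<Rightarrow> bool" where
  "omega2 G H \<longleftrightarrow> (\<exists>v \<in> pverts G. \<exists>w \<in> pverts G. v \<noteq> w \<and>
     (v, v) \<in> parcs G \<and> (w, w) \<notin> parcs G \<and>
     (\<forall>x \<in> pverts G - {v, w}. (x, v) \<in> parcs G \<longleftrightarrow> (x, w) \<in> parcs G) \<and>
     with_proj H = with_proj G \<restriction> (pverts G - {v, w}))"

text \<open>
  In \<open>three_vertex_graph E L\<close> the non-loop edges are listed in \<open>E\<close>, each in one direction, and
  \<open>L\<close> is the set of looped vertices. The middle vertex of the path is \<open>1\<close>.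
\<close>

definition three_vertex_graph :: "nat rel \<Rightarrow> nat set \<Rightarrow> nat pair_pre_digraph" where
  "three_vertex_graph E L = \<lparr> pverts = {0, 1, 2}, parcs = E \<union> E\<inverse> \<union> Id_on L \<rparr>"

definition omega3_graphs :: "nat pair_pre_digraph set" where
  "omega3_graphs =
     (let path = {(0, 1), (1, 2)}; triangle = {(0, 1), (1, 2), (0, 2)}
      in {three_vertex_graph path {0, 1, 2},
          three_vertex_graph path {},
          three_vertex_graph path {0, 1},
          three_vertex_graph path {0},
          three_vertex_graph triangle {0, 1},
          three_vertex_graph triangle {0}})"

definition omega3 :: "'a pair_pre_digraph \<Rightarrow> 'a pair_pre_digraph \<Rightarrow> bool" where
  "omega3 G H \<longleftrightarrow> (\<exists>u \<in> pverts G. \<exists>v \<in> pverts G. \<exists>w \<in> pverts G.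
     u \<noteq> v \<and> v \<noteq> w \<and> u \<noteq> w \<and>
     (\<forall>x \<in> pverts G - {u, v, w}.
        (\<exists>y \<in> {u, v, w}. (x, y) \<in> parcs G) \<longrightarrow> card {y \<in> {u, v, w}. (x, y) \<in> parcs G} = 2) \<and>
     (\<exists>K \<in> omega3_graphs.
        digraph_iso (with_proj K) (with_proj G \<restriction> {u, v, w}) \<or>
        digraph_iso (with_proj K) (with_proj H \<restriction> {u, v, w})) \<and>
     pverts H = pverts G \<and>
     parcs H = sym_diff (parcs G) {(x, y). x \<in> {u, v, w} \<and> y \<in> {u, v, w} \<and> x \<noteq> y})"

definition reidemeister_step :: "'a pair_pre_digraph \<Rightarrow> 'a pair_pre_digraph \<Rightarrow> bool" where
  "reidemeister_step G H \<longleftrightarrow> pair_pseudo_graph G \<and> pair_pseudo_graph H \<and>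
     (digraph_iso (with_proj G) (with_proj H) \<or> omega1 G H \<or> omega2 G H \<or> omega3 G H)"

text \<open>
  The moves are performed on isomorphic copies with natural numbers as vertices, so that new
  vertices are always available for adjoining, even if \<^typ>\<open>'a\<close> or \<^typ>\<open>'b\<close> is finite.
\<close>

definition reidemeister_equivalent :: "'a pair_pre_digraph \<Rightarrow> 'b pair_pre_digraph \<Rightarrow> bool" where
  "reidemeister_equivalent G G' \<longleftrightarrow> (\<exists>H H' :: nat pair_pre_digraph.
     digraph_iso (with_proj G) (with_proj H) \<and>
     equivclp reidemeister_step H H' \<and>
     digraph_iso (with_proj H') (with_proj G'))"

end

theory Submission
  imports Defs "HOL-Library.Discrete_Functions"
begin

text \<open>
  Write \<open>[G]\<close> for the bracket. A state is a set \<open>S\<close> of vertices at which the diagonal of the adjacency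
  form over \<open>GF(2)\<close> is changed, and it contributes \<open>d\<close> to the nullity of the changed form. Each move
  concerns at most three vertices; for a fixed choice of the state on the remaining vertices it is
  enough to compare the nullities of the two, four or eight ways to complete it. All of these
  comparisons are symmetric Gaussian elimination, carried out here by counting solutions: an
  elimination step is a bijection between solution sets, and the nullity is the binary logarithm of
  the number of solutions.

  \<^item> For an isolated vertex one of the two states adds a free variable and the other one forces the
    variable to be zero. So \<open>[G]\<close> is multiplied by \<open>A d + B\<close> or \<open>A + B d\<close>, which is \<open>- A^3\<close> or
    \<open>- A^(-3)\<close> after \<open>B = 1/A\<close> and \<open>d = - A^2 - A^(-2)\<close>. The factor \<open>(-1)^n t^((3n-6l)/4)\<close> in the
    Jones polynomial compensates exactly this.

  \<^item> For the two parallel vertices of the second move, replace \<open>w\<close> by \<open>v + w\<close>, whose row vanishes on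
    the other vertices. Three of the four states have nullities \<open>k\<close>, \<open>k\<close> and \<open>k + 1\<close> with weights \<open>A^2\<close>, \<open>B^2\<close>
    and \<open>A B\<close>, where \<open>k\<close> is the nullity with one of the two vertices removed and a
    prescribed diagonal entry at the other. They cancel because \<open>A^2 + B^2 + A B d = 0\<close>. The fourth state gives the
    nullity of the graph without \<open>v\<close> and \<open>w\<close>.

  \<^item> For the third move, replace \<open>w\<close> by \<open>u + v + w\<close>, whose row vanishes on the other vertices because
    each of them is adjacent to none or two of \<open>u\<close>, \<open>v\<close>, \<open>w\<close>. The products \<open>\<alpha>\<close>, \<open>\<beta>\<close>, \<open>\<gamma>\<close> of the new
    vector with \<open>u\<close>, \<open>v\<close>, \<open>w\<close> are the row sums of the 3 by 3 block. Toggling the three edges does not change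
    them, and the eight states run through all eight triples \<open>(\<alpha>, \<beta>, \<gamma>)\<close>. Only the five
    triples that are zero or have odd sum distinguish \<open>G\<close> from the toggled graph; with suitable \<open>x\<close> and
    \<open>y\<close> their nullities are \<open>x + 1, x, x, x, y\<close> before and \<open>y + 1, y, y, y, x\<close> after the move. The
    weighted sums agree unless the row sums of the block itself (in the empty state) are all equal,
    and the six graphs admitted in the third move are such that these row sums are not all equal.

  The passage between this coordinate-free bracket and the one defined by matrices rests on the
  fact that a space of dimension \<open>k\<close> over \<open>GF(2)\<close> has \<open>2^k\<close> elements (\<open>card_carrier_eq_power_dim\<close>). The
  moves are treated in \<open>bracket_insert_isolated\<close>, \<open>bracket_insert_parallel\<close> and
  \<open>bracket_toggle_triangle\<close>.
\<close>

text \<open>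
  By default sums and products of bits are rewritten to exclusive disjunctions and conjunctions; here
  they are to be treated as ring operations.
\<close>

declare add_bit_eq_xor [simp del] mult_bit_eq_and [simp del]

section \<open>The bracket of a symmetric form over GF(2)\<close>

text \<open>
  Vectors are functions on all of the vertex type that vanish outside of \<open>V\<close>. Hence the kernels for
  \<open>V\<close> and for \<open>insert v V\<close> live in the same type, and vertices can be split off without renumbering.
\<close>

definition supported :: "'a set \<Rightarrow> ('a \<Rightarrow> bit) set" where
  "supported V = {x. \<forall>u. u \<notin> V \<longrightarrow> x u = 0}"

definition ker :: "'a set \<Rightarrow> ('a \<Rightarrow> 'a \<Rightarrow> bit) \<Rightarrow> ('a \<Rightarrow> bit) set" where
  "ker V m = {x \<in> supported V. \<forall>u\<in>V. (\<Sum>v\<in>V. m u v * x v) = 0}"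

text \<open>
  The kernel has \<open>2^k\<close> elements, where \<open>k\<close> is its dimension. With the total function \<^const>\<open>floor_log\<close>
  doubling a nonzero count adds one, so that the eliminations below need not know that the
  count is a power of two.
\<close>

definition nullity :: "'a set \<Rightarrow> ('a \<Rightarrow> 'a \<Rightarrow> bit) \<Rightarrow> nat" where
  "nullity V m = floor_log (card (ker V m))"

definition add_diagonal :: "('a \<Rightarrow> 'a \<Rightarrow> bit) \<Rightarrow> 'a set \<Rightarrow> 'a \<Rightarrow> 'a \<Rightarrow> bit" where
  "add_diagonal a S u v = a u v + of_bool (u = v \<and> u \<in> S)"

definition state_sum :: "'a set \<Rightarrow> 'r \<Rightarrow> 'r \<Rightarrow> ('a set \<Rightarrow> 'r) \<Rightarrow> 'r::comm_ring_1" where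
  "state_sum V A B f = (\<Sum>S\<in>Pow V. A ^ card (V - S) * B ^ card S * f S)"

definition bracket :: "'a set \<Rightarrow> ('a \<Rightarrow> 'a \<Rightarrow> bit) \<Rightarrow> 'r \<Rightarrow> 'r \<Rightarrow> 'r \<Rightarrow> 'r::comm_ring_1" where
  "bracket V a A B d = state_sum V A B (\<lambda>S. d ^ nullity V (add_diagonal a S))"

lemma finite_supported:
  assumes "finite V"
  shows "finite (supported V)"
proof -
  have "supported V \<subseteq> (\<lambda>X u. of_bool (u \<in> X)) ` Pow V"
  proof
    fix x assume "x \<in> supported V"
    then have "x = (\<lambda>u. of_bool (u \<in> {u. x u = 1}))" "{u. x u = 1} \<in> Pow V"
      by (auto simp: supported_def fun_eq_iff)
    then show "x \<in> (\<lambda>X u. of_bool (u \<in> X)) ` Pow V" by blast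
  qed
  with assms show ?thesis by (meson finite_Pow_iff finite_imageI finite_subset)
qed

lemma finite_ker: "finite V \<Longrightarrow> finite (ker V m)"
  by (rule finite_subset[OF _ finite_supported]) (auto simp: ker_def)

lemma zero_supported: "(\<lambda>_. 0) \<in> supported V"
  by (simp add: supported_def)

lemma ker_cong:
  "(\<And>u v. u \<in> V \<Longrightarrow> v \<in> V \<Longrightarrow> m u v = m' u v) \<Longrightarrow> ker V m = ker V m'"
  unfolding ker_def by (intro Collect_cong conj_cong refl ball_cong) (auto intro: sum.cong)

lemma nullity_cong:
  "(\<And>u v. u \<in> V \<Longrightarrow> v \<in> V \<Longrightarrow> m u v = m' u v) \<Longrightarrow> nullity V m = nullity V m'"
  unfolding nullity_def using ker_cong by metis

lemma state_sum_cong: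
  "(\<And>S. S \<subseteq> V \<Longrightarrow> f S = g S) \<Longrightarrow> state_sum V A B f = state_sum V A B g"
  unfolding state_sum_def by (auto intro: sum.cong)

lemma state_sum_distrib_left: "state_sum V A B (\<lambda>S. c * f S) = c * state_sum V A B f"
  by (simp add: state_sum_def sum_distrib_left mult_ac)

text \<open>
  Peels one vertex off a state sum. Iterated, it leaves a sum over the states of the vertices that
  are not touched by a move, which can be compared term by term.
\<close>

lemma state_sum_insert:
  assumes "finite V" "x \<notin> V"
  shows "state_sum (insert x V) A B f = state_sum V A B (\<lambda>S. A * f S + B * f (insert x S))"
proof -
  let ?g = "\<lambda>S. A ^ card (insert x V - S) * B ^ card S * f S"
  have disj: "Pow V \<inter> insert x ` Pow V = {}" and inj: "inj_on (insert x) (Pow V)"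
    using \<open>x \<notin> V\<close> by (auto simp: inj_on_def)
  have 1: "?g S = A ^ card (V - S) * B ^ card S * (A * f S)"
    and 2: "?g (insert x S) = A ^ card (V - S) * B ^ card S * (B * f (insert x S))"
    if "S \<in> Pow V" for S
  proof -
    have fin: "finite S" and x: "x \<notin> S" using that assms by (auto intro: finite_subset)
    then have "insert x V - S = insert x (V - S)" "insert x V - insert x S = V - S"
      using \<open>x \<notin> V\<close> by auto
    then show "?g S = A ^ card (V - S) * B ^ card S * (A * f S)"
      "?g (insert x S) = A ^ card (V - S) * B ^ card S * (B * f (insert x S))"
      using fin x assms by (simp_all add: mult_ac)
  qed
  have "state_sum (insert x V) A B f = sum ?g (Pow V) + sum ?g (insert x ` Pow V)"
    unfolding state_sum_def Pow_insert using assms disj by (intro sum.union_disjoint) auto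
  also have "sum ?g (insert x ` Pow V) = (\<Sum>S\<in>Pow V. ?g (insert x S))"
    using inj by (simp add: sum.reindex)
  also have "sum ?g (Pow V) = (\<Sum>S\<in>Pow V. A ^ card (V - S) * B ^ card S * (A * f S))"
    by (rule sum.cong[OF refl 1])
  also have "(\<Sum>S\<in>Pow V. ?g (insert x S)) =
      (\<Sum>S\<in>Pow V. A ^ card (V - S) * B ^ card S * (B * f (insert x S)))"
    by (rule sum.cong[OF refl 2])
  finally show ?thesis
    by (simp only: state_sum_def sum.distrib distrib_left)
qed

lemma bracket_cong:
  assumes "\<And>u v. u \<in> V \<Longrightarrow> v \<in> V \<Longrightarrow> a u v = a' u v"
  shows "bracket V a A B d = bracket V a' A B d"
  unfolding bracket_def using assms
  by (intro state_sum_cong arg_cong[where f = "\<lambda>n. d ^ n"] nullity_cong) (simp add: add_diagonal_def)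

section \<open>Splitting off vertices from a kernel\<close>

lemma card_supported_insert:
  assumes "v \<notin> R"
  shows "card {x \<in> supported (insert v R). P x} =
    card {(b, y). y \<in> supported R \<and> P (y(v := b))}"
proof (rule bij_betw_same_card[of "\<lambda>x. (x v, x(v := 0))"], rule bij_betw_byWitness[where f' = "\<lambda>(b, y). y(v := b)"])
qed (use assms in \<open>auto simp: supported_def fun_eq_iff\<close>)

lemma card_supported_insert2:
  assumes "v \<notin> R" "w \<notin> R" "v \<noteq> w"
  shows "card {x \<in> supported (insert v (insert w R)). P x} =
    card {(b, c, y). y \<in> supported R \<and> P (y(v := b, w := c))}"
proof (rule bij_betw_same_card[of "\<lambda>x. (x v, x w, x(v := 0, w := 0))"],
    rule bij_betw_byWitness[where f' = "\<lambda>(b, c, y). y(v := b, w := c)"])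
qed (use assms in \<open>auto simp: supported_def fun_upd_twist fun_upd_idem_iff\<close>)

lemma card_supported_insert3:
  assumes "u \<notin> R" "v \<notin> R" "w \<notin> R" "u \<noteq> v" "u \<noteq> w" "v \<noteq> w"
  shows "card {x \<in> supported (insert u (insert v (insert w R))). P x} =
    card {(a, b, c, y). y \<in> supported R \<and> P (y(u := a, v := b, w := c))}"
proof (rule bij_betw_same_card[of "\<lambda>x. (x u, x v, x w, x(u := 0, v := 0, w := 0))"],
    rule bij_betw_byWitness[where f' = "\<lambda>(a, b, c, y). y(u := a, v := b, w := c)"])
qed (use assms in \<open>auto simp: supported_def fun_upd_twist fun_upd_idem_iff\<close>)

lemma sum_fun_upd_notin: "v \<notin> R \<Longrightarrow> (\<Sum>u\<in>R. m u * (y(v := b)) u) = (\<Sum>u\<in>R. m u * y u)"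
  for m :: "'a \<Rightarrow> bit"
  by (rule sum.cong) auto

lemma card_UNIV_bit: "card (UNIV :: bit set) = 2"
proof -
  have *: "(UNIV :: bit set) = {0, 1}" by (auto intro: bit.exhaust)
  have "card {0, 1 :: bit} = 2" by simp
  with * show ?thesis by (simp only:)
qed

section \<open>Isolated vertices\<close>

lemma card_ker_insert:
  assumes "finite R" "v \<notin> R"
  shows "card (ker (insert v R) m) = card {(b, y). y \<in> supported R \<and>
    m v v * b + (\<Sum>x\<in>R. m v x * y x) = 0 \<and> (\<forall>u\<in>R. m u v * b + (\<Sum>x\<in>R. m u x * y x) = 0)}"
  unfolding ker_def using assms
  by (subst card_supported_insert) (simp_all add: sum_fun_upd_notin del: fun_upd_apply add: fun_upd_same)

lemma card_ker_pos: "finite V \<Longrightarrow> card (ker V m) \<noteq> 0"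
  using finite_ker[of V m] zero_supported[of V] by (auto simp: ker_def)

text \<open>
  The equation at the isolated vertex \<open>v\<close> involves only the variable at \<open>v\<close>: this variable is free
  or zero, according to the diagonal entry.
\<close>

lemma nullity_insert_isolated:
  assumes "finite R" "v \<notin> R" "\<And>x. x \<in> R \<Longrightarrow> m v x = 0" "\<And>x. x \<in> R \<Longrightarrow> m x v = 0"
  shows "nullity (insert v R) m = (if m v v = 0 then Suc (nullity R m) else nullity R m)"
proof -
  have "card (ker (insert v R) m) = card {(b, y). y \<in> ker R m \<and> m v v * b = 0}"
    unfolding card_ker_insert[OF assms(1,2)] using assms(3,4)
    by (intro arg_cong[where f = card]) (auto simp: ker_def)
  also have "{(b, y). y \<in> ker R m \<and> m v v * b = 0} = (if m v v = 0 then UNIV else {0}) \<times> ker R m"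
    by auto
  finally show ?thesis using card_ker_pos[OF \<open>finite R\<close>, of m]
    by (simp add: nullity_def card_cartesian_product card_UNIV_bit)
qed

lemma bracket_insert_isolated:
  assumes "finite R" "v \<notin> R" "\<And>x. x \<in> R \<Longrightarrow> a v x = 0" "\<And>x. x \<in> R \<Longrightarrow> a x v = 0"
  shows "bracket (insert v R) a A B d = (if a v v = 0 then A * d + B else A + B * d) * bracket R a A B d"
proof -
  have 1: "nullity (insert v R) (add_diagonal a S') =
      (if add_diagonal a S' v v = 0 then Suc (nullity R (add_diagonal a S)) else nullity R (add_diagonal a S))"
    if "S \<subseteq> R" "S' \<in> {S, insert v S}" for S S'
  proof -
    have "nullity R (add_diagonal a S') = nullity R (add_diagonal a S)"
      using that \<open>v \<notin> R\<close> by (intro nullity_cong) (auto simp: add_diagonal_def)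
    moreover have "add_diagonal a S' v x = 0" "add_diagonal a S' x v = 0" if "x \<in> R" for x
      using that assms by (auto simp: add_diagonal_def)
    ultimately show ?thesis
      using nullity_insert_isolated[OF assms(1,2), of "add_diagonal a S'"] by simp
  qed
  have 2: "add_diagonal a S v v = a v v" "add_diagonal a (insert v S) v v = a v v + 1" if "S \<subseteq> R" for S
    using that \<open>v \<notin> R\<close> by (auto simp: add_diagonal_def)
  show ?thesis
    unfolding bracket_def state_sum_insert[OF assms(1,2)] state_sum_distrib_left[symmetric]
    by (rule state_sum_cong) (cases "a v v", simp_all add: 1 2 algebra_simps)
qed

section \<open>Parallel vertices\<close>

lemma card_ker_insert2:
  assumes "finite R" "v \<notin> R" "w \<notin> R" "v \<noteq> w"
  shows "card (ker (insert v (insert w R)) m) = card {(b, c, y). y \<in> supported R \<and>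
    m v v * b + m v w * c + (\<Sum>x\<in>R. m v x * y x) = 0 \<and>
    m w v * b + m w w * c + (\<Sum>x\<in>R. m w x * y x) = 0 \<and>
    (\<forall>u\<in>R. m u v * b + m u w * c + (\<Sum>x\<in>R. m u x * y x) = 0)}"
  unfolding ker_def using assms
  by (subst card_supported_insert2)
     (simp_all add: sum_fun_upd_notin add.assoc del: fun_upd_apply add: fun_upd_same fun_upd_other)

text \<open>
  The next three lemmas eliminate a variable from the two equations belonging to parallel
  vertices. Here \<open>p\<close>, \<open>q\<close> are their diagonal entries, \<open>e\<close> is the entry between them, \<open>\<phi>\<close> is the
  common contribution of the other vertices, and \<open>Q\<close> stands for the equations at the other
  vertices, in which \<open>a\<close> and \<open>b\<close> only occur through \<open>c = a + b\<close>. The sum of the two equations is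
  \<open>(p + e) a + (q + e) b = 0\<close>. If \<open>p \<noteq> q\<close>, it determines \<open>a\<close> and \<open>b\<close> from \<open>c\<close>.
\<close>

lemma card_parallel_odd:
  fixes e :: bit
  assumes "p + q = 1"
  shows "card {(a, b, y). y \<in> F \<and> p * a + e * b + \<phi> y = 0 \<and> e * a + q * b + \<phi> y = 0 \<and> Q (a + b) y} =
    card {(c, y). y \<in> F \<and> e * c + \<phi> y = 0 \<and> Q c y}"
proof (rule bij_betw_same_card[of "\<lambda>(a, b, y). (a + b, y)"],
    rule bij_betw_byWitness[where f' = "\<lambda>(c, y). (c + (p + e) * c, (p + e) * c, y)"])
qed (use assms in \<open>cases p; cases q; cases e; auto simp: add_bit_eq_xor mult_bit_eq_and\<close>)+

text \<open>
  If \<open>p = q \<noteq> e\<close>, the sum of the equations says \<open>c = 0\<close>, and then \<open>a = b\<close> is determined by \<open>\<phi>\<close>.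
\<close>

lemma card_parallel_even_neq:
  fixes e :: bit
  assumes "p \<noteq> e"
  shows "card {(a, b, y). y \<in> F \<and> p * a + e * b + \<phi> y = 0 \<and> e * a + p * b + \<phi> y = 0 \<and> Q (a + b) y} =
    card {y \<in> F. Q 0 y}"
proof (rule bij_betw_same_card[of "\<lambda>(a, b, y). y"],
    rule bij_betw_byWitness[where f' = "\<lambda>y. (\<phi> y, \<phi> y, y)"])
qed (use assms in \<open>cases p; cases e; auto simp: add_bit_eq_xor mult_bit_eq_and\<close>)+

text \<open>
  If \<open>p = q = e\<close>, the two equations coincide and \<open>a\<close> is free once \<open>c\<close> is fixed.
\<close>

lemma card_parallel_even_eq:
  fixes e :: bit
  shows "card {(a, b, y). y \<in> F \<and> e * a + e * b + \<phi> y = 0 \<and> e * a + e * b + \<phi> y = 0 \<and> Q (a + b) y} =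
    2 * card {(c, y). y \<in> F \<and> e * c + \<phi> y = 0 \<and> Q c y}" (is "card ?L = 2 * card ?R")
proof -
  have "card ?L = card ((UNIV :: bit set) \<times> ?R)"
  proof (rule bij_betw_same_card[of "\<lambda>(a, b, y). (a, a + b, y)"],
      rule bij_betw_byWitness[where f' = "\<lambda>(a, c, y). (a, a + c, y)"])
  qed (cases e; auto simp: add_bit_eq_xor mult_bit_eq_and)+
  then show ?thesis by (simp add: card_cartesian_product card_UNIV_bit)
qed

text \<open>
  The form on the right lives on one of the two parallel vertices, with the off-diagonal entry
  \<open>m v w\<close> moved to the diagonal. If \<open>m v v \<noteq> m w w\<close>, the vector \<open>v + w\<close> has product 1 with itself and
  this form is its Schur complement; if all three entries are equal, it is just the restriction of \<open>m\<close>.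
\<close>

lemma nullity_insert_parallel:
  assumes "finite R" "v \<notin> R" "w \<notin> R" "v \<noteq> w" "m w v = m v w"
    and "\<And>x. x \<in> R \<Longrightarrow> m w x = m v x" "\<And>x. x \<in> R \<Longrightarrow> m x w = m x v"
  shows "nullity (insert v (insert w R)) m =
    (if m v v \<noteq> m w w then nullity (insert v R) (m(v := (m v)(v := m v w)))
     else if m v v \<noteq> m v w then nullity R m
     else Suc (nullity (insert v R) (m(v := (m v)(v := m v w)))))"
proof -
  define \<phi> where "\<phi> y = (\<Sum>x\<in>R. m v x * y x)" for y
  define Q where "Q c y \<longleftrightarrow> (\<forall>u\<in>R. m u v * c + (\<Sum>x\<in>R. m u x * y x) = 0)" for c y
  let ?m = "m(v := (m v)(v := m v w))"
  have cvw: "card (ker (insert v (insert w R)) m) = card {(a, b, y). y \<in> supported R \<and>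
      m v v * a + m v w * b + \<phi> y = 0 \<and> m v w * a + m w w * b + \<phi> y = 0 \<and> Q (a + b) y}"
    unfolding card_ker_insert2[OF assms(1-4)] Q_def \<phi>_def
    using assms(5-7) by (intro arg_cong[where f = card]) (auto simp: distrib_left)
  have cv: "card (ker (insert v R) ?m) =
      card {(c, y). y \<in> supported R \<and> m v w * c + \<phi> y = 0 \<and> Q c y}"
  proof -
    have "(\<Sum>x\<in>R. (if x = v then k else m v x) * y x) = (\<Sum>x\<in>R. m v x * y x)" for k y
      using \<open>v \<notin> R\<close> by (intro sum.cong) auto
    moreover have "u \<noteq> v" if "u \<in> R" for u using that \<open>v \<notin> R\<close> by auto
    ultimately show ?thesis
      unfolding card_ker_insert[OF assms(1,2)] Q_def \<phi>_def by (simp cong: conj_cong)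
  qed
  have c0: "card (ker R m) = card {y \<in> supported R. Q 0 y}"
    by (simp add: ker_def Q_def)
  consider "m v v + m w w = 1" "m v v \<noteq> m w w" | "m w w = m v v" "m v v \<noteq> m v w"
    | "m w w = m v v" "m v w = m v v"
    by (cases "m v v"; cases "m w w"; cases "m v w") auto
  then show ?thesis
  proof cases
    case 1
    then show ?thesis by (simp add: nullity_def cvw cv card_parallel_odd)
  next
    case 2
    then show ?thesis unfolding nullity_def cvw c0
      by (simp add: card_parallel_even_neq)
  next
    case 3
    have "card (ker (insert v R) ?m) \<noteq> 0" using card_ker_pos[of "insert v R"] \<open>finite R\<close> by simp
    then show ?thesis
      using 3 card_parallel_even_eq[where e = "m v w" and F = "supported R" and \<phi> = \<phi> and Q = Q]
      unfolding nullity_def cvw cv by simp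
  qed
qed

text \<open>
  As \<open>v\<close> is looped and \<open>w\<close> is not, the diagonal entries differ in the states in which both or none
  of \<open>v\<close>, \<open>w\<close> are changed. Of the other two states, one has the nullity of \<open>R\<close> and one gains a
  dimension; the edge between \<open>v\<close> and \<open>w\<close> decides which, but their weights are both \<open>A B = 1\<close>.
\<close>

lemma bracket_insert_parallel:
  assumes "finite R" "v \<notin> R" "w \<notin> R" "v \<noteq> w" "a w v = a v w"
    and "\<And>x. x \<in> R \<Longrightarrow> a w x = a v x" "\<And>x. x \<in> R \<Longrightarrow> a x w = a x v"
    and "a v v = 1" "a w w = 0" and "A * B = 1" "d = - A\<^sup>2 - B\<^sup>2"
  shows "bracket (insert v (insert w R)) a A B d = bracket R a A B d"
proof -
  define n where "n S = nullity (insert v R) ((add_diagonal a S)(v := (a v)(v := a v w)))" for S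
  let ?k = "\<lambda>S. nullity R (add_diagonal a S)"
  have *: "nullity (insert v (insert w R)) (add_diagonal a S') =
      (if add_diagonal a S' v v \<noteq> add_diagonal a S' w w then n S
       else if add_diagonal a S' v v \<noteq> a v w then ?k S else Suc (n S))"
    if "S \<subseteq> R" "S' \<inter> R = S" for S S'
  proof -
    let ?m = "add_diagonal a S'"
    have vw: "?m v w = a v w" using \<open>v \<noteq> w\<close> by (simp add: add_diagonal_def)
    have "?m w v = ?m v w" "\<And>x. x \<in> R \<Longrightarrow> ?m w x = ?m v x" "\<And>x. x \<in> R \<Longrightarrow> ?m x w = ?m x v"
      using assms by (auto simp: add_diagonal_def)
    note nullity_insert_parallel[where m = ?m, OF assms(1-4) this]
    moreover have "nullity R ?m = ?k S"
      using that by (intro nullity_cong) (auto simp: add_diagonal_def)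
    moreover have "nullity (insert v R) (?m(v := (?m v)(v := a v w))) = n S"
      unfolding n_def using that assms by (intro nullity_cong) (auto simp: add_diagonal_def)
    ultimately show ?thesis by (simp only: vw)
  qed
  have "A * (A * d ^ nullity (insert v (insert w R)) (add_diagonal a S) +
           B * d ^ nullity (insert v (insert w R)) (add_diagonal a (insert v S))) +
      B * (A * d ^ nullity (insert v (insert w R)) (add_diagonal a (insert w S)) +
           B * d ^ nullity (insert v (insert w R)) (add_diagonal a (insert v (insert w S)))) =
      d ^ ?k S" (is "?lhs = _") if "S \<subseteq> R" for S
  proof -
    have mem: "v \<notin> S" "w \<notin> S" using that assms by auto
    have int: "S \<inter> R = S" "insert w S \<inter> R = S" "insert v S \<inter> R = S" "insert v (insert w S) \<inter> R = S"
      using that assms by auto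
    have "?lhs = A * (A * d ^ n S) + B * (B * d ^ n S) + (A * B) * (d ^ ?k S + d * d ^ n S)"
      unfolding *[OF that int(1)] *[OF that int(2)] *[OF that int(3)] *[OF that int(4)]
      using mem assms(4,8,9) by (cases "a v w") (simp_all add: add_diagonal_def algebra_simps)
    then show ?thesis by (simp add: assms(10,11) power2_eq_square algebra_simps)
  qed
  note key = this
  have "finite (insert w R)" "v \<notin> insert w R" using assms by auto
  then show ?thesis
    unfolding bracket_def state_sum_insert[OF \<open>finite (insert w R)\<close> \<open>v \<notin> insert w R\<close>]
      state_sum_insert[OF assms(1,3)]
    by (intro state_sum_cong key)
qed

section \<open>Triangles\<close>

lemma card_ker_insert3:
  assumes "finite R" "u \<notin> R" "v \<notin> R" "w \<notin> R" "u \<noteq> v" "u \<noteq> w" "v \<noteq> w"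
  shows "card (ker (insert u (insert v (insert w R))) m) = card {(a, b, c, y). y \<in> supported R \<and>
    m u u * a + m u v * b + m u w * c + (\<Sum>x\<in>R. m u x * y x) = 0 \<and>
    m v u * a + m v v * b + m v w * c + (\<Sum>x\<in>R. m v x * y x) = 0 \<and>
    m w u * a + m w v * b + m w w * c + (\<Sum>x\<in>R. m w x * y x) = 0 \<and>
    (\<forall>z\<in>R. m z u * a + m z v * b + m z w * c + (\<Sum>x\<in>R. m z x * y x) = 0)}"
  unfolding ker_def using assms
  by (subst card_supported_insert3)
     (simp_all add: sum_fun_upd_notin add.assoc del: fun_upd_apply add: fun_upd_same fun_upd_other)

text \<open>
  The change of basis from \<open>u, v, w\<close> to \<open>u, v, u + v + w\<close>: a vector with coordinates \<open>a, b, c\<close> gets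
  the coordinates \<open>a + c, b + c, c\<close>. The block has diagonal \<open>p, q, r\<close> and off-diagonal entries
  \<open>e\<close> (for \<open>uv\<close>), \<open>f\<close> (for \<open>uw\<close>) and \<open>g\<close> (for \<open>vw\<close>); the outer parts of its rows are \<open>\<phi>\<close>,
  \<open>\<psi>\<close> and \<open>\<phi> + \<psi>\<close>. In the new third equation, the sum of the three old ones, the outer parts
  cancel. Its coefficients are the row sums of the block and their sum.
\<close>

lemma card_triangle_shift:
  fixes p q r e f g :: bit
  shows "card {(a, b, c, y). y \<in> F \<and> p * a + e * b + f * c + \<phi> y = 0 \<and> e * a + q * b + g * c + \<psi> y = 0 \<and>
      f * a + g * b + r * c + (\<phi> y + \<psi> y) = 0 \<and> Q (a + c) (b + c) y} =
    card {(a, b, c, y). y \<in> F \<and> p * a + e * b + (p + e + f) * c + \<phi> y = 0 \<and>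
      e * a + q * b + (q + e + g) * c + \<psi> y = 0 \<and>
      (p + e + f) * a + (q + e + g) * b + ((p + e + f) + (q + e + g) + (r + f + g)) * c = 0 \<and> Q a b y}"
    (is "card ?L = card ?R")
proof -
  have 1: "p * a + e * b + f * c = p * (a + c) + e * (b + c) + (p + e + f) * c" for p e f a b c :: bit
    by (cases p; cases e; cases f; cases c) simp_all
  have 2: "e * a + q * b + g * c = e * (a + c) + q * (b + c) + (q + e + g) * c" for a b c
    using 1[of e a q b g c] by (simp add: ac_simps)
  have 3: "f * a + g * b + r * c + (x + y) = (p + e + f) * (a + c) + (q + e + g) * (b + c) +
      ((p + e + f) + (q + e + g) + (r + f + g)) * c"
    if "p * a + e * b + f * c + x = 0" "e * a + q * b + g * c + y = 0" for a b c x y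
  proof -
    have "x = p * a + e * b + f * c" "y = e * a + q * b + g * c"
      using that by (auto simp: add_eq_0_iff)
    then show ?thesis by (cases a; cases b; cases c) (simp_all add: ac_simps)
  qed
  have iff: "(a + c, b + c, c, y) \<in> ?R \<longleftrightarrow> (a, b, c, y) \<in> ?L" for a b c y
    using 3[of a b c "\<phi> y" "\<psi> y"] unfolding mem_Collect_eq prod.case
    by (auto simp flip: 1 2)
  have cancel: "a + c + c = a" for a c :: bit by (cases c) simp_all
  have iff': "(a + c, b + c, c, y) \<in> ?L \<longleftrightarrow> (a, b, c, y) \<in> ?R" for a b c y
    using iff[of "a + c" c "b + c" y] by (simp only: cancel)
  show ?thesis
  proof (rule bij_betw_same_card[of "\<lambda>(a, b, c, y). (a + c, b + c, c, y)"],
      rule bij_betw_byWitness[where f' = "\<lambda>(a, b, c, y). (a + c, b + c, c, y)"])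
    show "(\<lambda>(a, b, c, y). (a + c, b + c, c, y)) ` ?L \<subseteq> ?R"
    proof (rule image_subsetI)
      fix x assume "x \<in> ?L"
      then show "(case x of (a, b, c, y) \<Rightarrow> (a + c, b + c, c, y)) \<in> ?R"
        by (cases x) (simp only: prod.case iff)
    qed
    show "(\<lambda>(a, b, c, y). (a + c, b + c, c, y)) ` ?R \<subseteq> ?L"
    proof (rule image_subsetI)
      fix x assume "x \<in> ?R"
      then show "(case x of (a, b, c, y) \<Rightarrow> (a + c, b + c, c, y)) \<in> ?L"
        by (cases x) (simp only: prod.case iff')
    qed
  qed (auto simp: cancel)
qed

text \<open>
  If the vector \<open>u + v + w\<close> has product 1 with itself, its equation determines \<open>c\<close>; substituting it
  changes the block on \<open>u, v\<close> by a rank one matrix.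
\<close>

lemma card_triangle_odd:
  fixes p q e :: bit
  shows "card {(a, b, c, y). y \<in> F \<and> p * a + e * b + \<alpha> * c + \<phi> y = 0 \<and>
      e * a + q * b + \<beta> * c + \<psi> y = 0 \<and> \<alpha> * a + \<beta> * b + c = 0 \<and> Q a b y} =
    card {(a, b, y). y \<in> F \<and> (p + \<alpha>) * a + (e + \<alpha> * \<beta>) * b + \<phi> y = 0 \<and>
      (e + \<alpha> * \<beta>) * a + (q + \<beta>) * b + \<psi> y = 0 \<and> Q a b y}"
proof -
  have c: "\<alpha> * a + \<beta> * b + c = 0 \<longleftrightarrow> c = \<alpha> * a + \<beta> * b" for a b c
    by (cases "\<alpha> * a + \<beta> * b"; cases c) simp_all
  have 1: "p * a + e * b + \<alpha> * (\<alpha> * a + \<beta> * b) = (p + \<alpha>) * a + (e + \<alpha> * \<beta>) * b" for p a b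
    by (cases \<alpha>) (simp_all add: distrib_left distrib_right ac_simps)
  have 2: "e * a + q * b + \<beta> * (\<alpha> * a + \<beta> * b) = (e + \<alpha> * \<beta>) * a + (q + \<beta>) * b" for q a b
    by (cases \<beta>) (simp_all add: distrib_left distrib_right ac_simps)
  show ?thesis
    unfolding c
  proof (rule bij_betw_same_card[of "\<lambda>(a, b, c, y). (a, b, y)"],
      rule bij_betw_byWitness[where f' = "\<lambda>(a, b, y). (a, b, \<alpha> * a + \<beta> * b, y)"])
  qed (auto simp: 1 2)
qed

text \<open>
  If all row sums vanish, the coordinate \<open>c\<close> does not occur in any equation and is free.
\<close>

lemma card_triangle_zero:
  fixes p q e :: bit
  shows "card {(a, b, c :: bit, y). y \<in> F \<and> p * a + e * b + \<phi> y = 0 \<and> e * a + q * b + \<psi> y = 0 \<and> Q a b y} =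
    2 * card {(a, b, y). y \<in> F \<and> p * a + e * b + \<phi> y = 0 \<and> e * a + q * b + \<psi> y = 0 \<and> Q a b y}"
    (is "card ?L = 2 * card ?R")
proof -
  have "card ?L = card ((UNIV :: bit set) \<times> ?R)"
  proof (rule bij_betw_same_card[of "\<lambda>(a, b, c, y). (c, a, b, y)"],
      rule bij_betw_byWitness[where f' = "\<lambda>(c, a, b, y). (a, b, c, y)"])
  qed auto
  then show ?thesis by (simp add: card_cartesian_product card_UNIV_bit)
qed

text \<open>
  If the vector \<open>u + v + w\<close> has product 0 with itself but not with both \<open>u\<close> and \<open>v\<close>, its equation is a
  nontrivial relation between \<open>a\<close> and \<open>b\<close>. Modulo this relation, toggling \<open>e\<close> amounts to adding to \<open>c\<close> a
  linear combination of \<open>a\<close> and \<open>b\<close>.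
\<close>

lemma card_triangle_even:
  fixes p q e :: bit
  assumes "\<not> (\<alpha> = 0 \<and> \<beta> = 0)"
  shows "card {(a, b, c, y). y \<in> F \<and> p * a + e * b + \<alpha> * c + \<phi> y = 0 \<and>
      e * a + q * b + \<beta> * c + \<psi> y = 0 \<and> \<alpha> * a + \<beta> * b = 0 \<and> Q a b y} =
    card {(a, b, c, y). y \<in> F \<and> p * a + (e + 1) * b + \<alpha> * c + \<phi> y = 0 \<and>
      (e + 1) * a + q * b + \<beta> * c + \<psi> y = 0 \<and> \<alpha> * a + \<beta> * b = 0 \<and> Q a b y}"
proof -
  \<comment> \<open>This is b, a or a = b according as the relation is a = 0, b = 0 or a = b.\<close>
  let ?k = "\<lambda>a b. \<alpha> * b + (\<alpha> + 1) * a"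
  have 1: "p * a + (e + 1) * b + \<alpha> * (c + ?k a b) = p * a + e * b + \<alpha> * c"
      "p * a + e * b + \<alpha> * (c + ?k a b) = p * a + (e + 1) * b + \<alpha> * c"
    if "\<alpha> * a + \<beta> * b = 0" for a b c
    using that assms by (cases \<alpha>; cases \<beta>; cases a; cases b; simp add: ac_simps)+
  have 2: "(e + 1) * a + q * b + \<beta> * (c + ?k a b) = e * a + q * b + \<beta> * c"
      "e * a + q * b + \<beta> * (c + ?k a b) = (e + 1) * a + q * b + \<beta> * c"
    if "\<alpha> * a + \<beta> * b = 0" for a b c
    using that assms by (cases \<alpha>; cases \<beta>; cases a; cases b; simp add: ac_simps)+
  have k: "c + k + k = c" for c k :: bit by (cases k) simp_all
  show ?thesis
  proof (rule bij_betw_same_card[of "\<lambda>(a, b, c, y). (a, b, c + ?k a b, y)"],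
      rule bij_betw_byWitness[where f' = "\<lambda>(a, b, c, y). (a, b, c + ?k a b, y)"])
  qed (auto simp only: image_subset_iff Ball_def split_paired_All mem_Collect_eq prod.case k 1 2)
qed

definition pair_form :: "('a \<Rightarrow> 'a \<Rightarrow> bit) \<Rightarrow> 'a \<Rightarrow> 'a \<Rightarrow> bit \<Rightarrow> bit \<Rightarrow> bit \<Rightarrow> 'a \<Rightarrow> 'a \<Rightarrow> bit" where
  "pair_form m u v p q t = m(u := (m u)(u := p, v := t), v := (m v)(u := t, v := q))"

definition toggle :: "'a set \<Rightarrow> ('a \<Rightarrow> 'a \<Rightarrow> bit) \<Rightarrow> 'a \<Rightarrow> 'a \<Rightarrow> bit" where
  "toggle T m x y = m x y + of_bool (x \<in> T \<and> y \<in> T \<and> x \<noteq> y)"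

lemma card_ker_pair_form:
  assumes "finite R" "u \<notin> R" "v \<notin> R" "u \<noteq> v"
  shows "card (ker (insert u (insert v R)) (pair_form m u v p q t)) = card {(a, b, y). y \<in> supported R \<and>
    p * a + t * b + (\<Sum>x\<in>R. m u x * y x) = 0 \<and> t * a + q * b + (\<Sum>x\<in>R. m v x * y x) = 0 \<and>
    (\<forall>z\<in>R. m z u * a + m z v * b + (\<Sum>x\<in>R. m z x * y x) = 0)}"
proof -
  let ?m = "pair_form m u v p q t"
  have "?m u u = p" "?m u v = t" "?m v u = t" "?m v v = q"
    using \<open>u \<noteq> v\<close> by (simp_all add: pair_form_def)
  moreover have "(\<Sum>x\<in>R. ?m z x * y x) = (\<Sum>x\<in>R. m z x * y x)" for z y
    using assms by (intro sum.cong) (auto simp: pair_form_def)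
  moreover have "?m z u = m z u" "?m z v = m z v" if "z \<in> R" for z
    using that assms by (auto simp: pair_form_def)
  ultimately show ?thesis
    unfolding card_ker_insert2[OF assms] by (simp cong: conj_cong ball_cong)
qed

lemma card_ker_triangle:
  assumes "finite R" "u \<notin> R" "v \<notin> R" "w \<notin> R" "u \<noteq> v" "u \<noteq> w" "v \<noteq> w"
    and "m v u = m u v" "m w u = m u w" "m w v = m v w"
    and "\<forall>x\<in>R. m w x = m u x + m v x" "\<forall>x\<in>R. m x w = m x u + m x v"
    and "\<alpha> = m u u + m u v + m u w" "\<beta> = m v v + m u v + m v w" "\<gamma> = m w w + m u w + m v w"
  shows "card (ker (insert u (insert v (insert w R))) m) = card {(a, b, c, y). y \<in> supported R \<and>
      m u u * a + m u v * b + \<alpha> * c + (\<Sum>x\<in>R. m u x * y x) = 0 \<and>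
      m u v * a + m v v * b + \<beta> * c + (\<Sum>x\<in>R. m v x * y x) = 0 \<and>
      \<alpha> * a + \<beta> * b + (\<alpha> + \<beta> + \<gamma>) * c = 0 \<and>
      (\<forall>z\<in>R. m z u * a + m z v * b + (\<Sum>x\<in>R. m z x * y x) = 0)}"
proof -
  have w: "(\<Sum>x\<in>R. m w x * y x) = (\<Sum>x\<in>R. m u x * y x) + (\<Sum>x\<in>R. m v x * y x)" for y
    unfolding sum.distrib[symmetric] using assms(11) by (intro sum.cong) (simp_all add: distrib_right)
  have z: "m z u * a + m z v * b + m z w * c = m z u * (a + c) + m z v * (b + c)" if "z \<in> R" for z a b c
    using assms(12) that by (cases c) (simp_all add: distrib_left distrib_right ac_simps)
  show ?thesis
    unfolding card_ker_insert3[OF assms(1-7)] w assms(8-10,13-15)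
    by (subst card_triangle_shift[symmetric]) (simp add: z cong: ball_cong)
qed

text \<open>
  The result of the elimination in terms of the row sums \<open>\<alpha>\<close>, \<open>\<beta>\<close>, \<open>\<gamma>\<close> of the block. In the
  first two cases the form that remains on \<open>u\<close>, \<open>v\<close> depends on the block only through the sums
  \<open>m u v + m u w\<close> and \<open>m u v + m v w\<close>, which are not changed by toggling, and through a single bit,
  which is changed. In the third case toggling does not matter.
\<close>

lemma nullity_insert_triangle:
  assumes "finite R" "u \<notin> R" "v \<notin> R" "w \<notin> R" "u \<noteq> v" "u \<noteq> w" "v \<noteq> w"
    and "m v u = m u v" "m w u = m u w" "m w v = m v w"
    and "\<forall>x\<in>R. m w x = m u x + m v x" "\<forall>x\<in>R. m x w = m x u + m x v"
    and \<alpha>: "\<alpha> = m u u + m u v + m u w" and \<beta>: "\<beta> = m v v + m u v + m v w" and \<gamma>: "\<gamma> = m w w + m u w + m v w"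
  defines "N \<equiv> \<lambda>t. nullity (insert u (insert v R)) (pair_form m u v (m u v + m u w) (m u v + m v w) t)"
    and "V \<equiv> insert u (insert v (insert w R))"
  shows "\<alpha> = 0 \<Longrightarrow> \<beta> = 0 \<Longrightarrow> \<gamma> = 0 \<Longrightarrow> nullity V m = Suc (N (m u v))"
    and "\<alpha> + \<beta> + \<gamma> = 1 \<Longrightarrow> nullity V m = N (m u v + \<alpha> * \<beta>)"
    and "\<alpha> + \<beta> + \<gamma> = 0 \<Longrightarrow> \<not> (\<alpha> = 0 \<and> \<beta> = 0) \<Longrightarrow> nullity V (toggle {u, v, w} m) = nullity V m"
proof -
  note T = card_ker_triangle[where m = m, OF assms(1-15), folded V_def]
  note P = card_ker_pair_form[where m = m, OF assms(1-3,5)]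
  have diag: "m u u + \<alpha> = m u v + m u w" "m v v + \<beta> = m u v + m v w"
    unfolding \<alpha> \<beta> by (cases "m u u"; cases "m v v"; simp)+
  show "nullity V m = Suc (N (m u v))" if "\<alpha> = 0" "\<beta> = 0" "\<gamma> = 0"
  proof -
    have "m u v + m u w = m u u" "m u v + m v w = m v v" using diag that by auto
    then have "card (ker V m) = 2 * card (ker (insert u (insert v R))
        (pair_form m u v (m u v + m u w) (m u v + m v w) (m u v)))"
      unfolding T P using that by (simp add: card_triangle_zero)
    then show ?thesis unfolding nullity_def N_def using \<open>finite R\<close> by (simp add: card_ker_pos)
  qed
  show "nullity V m = N (m u v + \<alpha> * \<beta>)" if "\<alpha> + \<beta> + \<gamma> = 1"
  proof -
    have "card (ker V m) = card (ker (insert u (insert v R))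
        (pair_form m u v (m u v + m u w) (m u v + m v w) (m u v + \<alpha> * \<beta>)))"
      unfolding T P that mult_1_left card_triangle_odd diag ..
    then show ?thesis unfolding nullity_def N_def by simp
  qed
  show "nullity V (toggle {u, v, w} m) = nullity V m"
    if "\<alpha> + \<beta> + \<gamma> = 0" "\<not> (\<alpha> = 0 \<and> \<beta> = 0)"
  proof -
    let ?m = "toggle {u, v, w} m"
    have off: "?m u v = m u v + 1" "?m v u = m u v + 1" "?m u w = m u w + 1" "?m w u = m u w + 1"
      "?m v w = m v w + 1" "?m w v = m v w + 1" "?m u u = m u u" "?m v v = m v v" "?m w w = m w w"
      using assms(5-10) by (simp_all add: toggle_def)
    have R: "?m x y = m x y" if "x \<in> R \<or> y \<in> R" for x y
      using that assms(2-4) by (auto simp: toggle_def)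
    have two: "x + (y + 1) + (z + 1) = x + y + z" for x y z :: bit by (cases y; cases z) simp_all
    have "card (ker V ?m) = card {(a, b, c, y). y \<in> supported R \<and>
        m u u * a + (m u v + 1) * b + \<alpha> * c + (\<Sum>x\<in>R. m u x * y x) = 0 \<and>
        (m u v + 1) * a + m v v * b + \<beta> * c + (\<Sum>x\<in>R. m v x * y x) = 0 \<and>
        \<alpha> * a + \<beta> * b + (\<alpha> + \<beta> + \<gamma>) * c = 0 \<and>
        (\<forall>z\<in>R. m z u * a + m z v * b + (\<Sum>x\<in>R. m z x * y x) = 0)}"
      unfolding V_def
      by (subst card_ker_triangle[where \<alpha> = \<alpha> and \<beta> = \<beta> and \<gamma> = \<gamma>, OF assms(1-7)])
         (simp_all add: off R two assms(11,12) \<alpha> \<beta> \<gamma> cong: sum.cong ball_cong)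
    also have "\<dots> = card (ker V m)"
      unfolding T that(1) mult_zero_left add_0_right
      by (rule card_triangle_even[OF that(2), symmetric])
    finally show ?thesis by (simp add: nullity_def)
  qed
qed

text \<open>
  The contribution of the eight ways to complete a state at \<open>u\<close>, \<open>v\<close>, \<open>w\<close>, nested in the way in which
  three applications of \<open>state_sum_insert\<close> produce it. The arguments of \<open>n\<close> tell whether the
  diagonal is changed at \<open>u\<close>, \<open>v\<close>, \<open>w\<close>.
\<close>

definition triangle_states :: "'r \<Rightarrow> 'r \<Rightarrow> 'r \<Rightarrow> (bit \<Rightarrow> bit \<Rightarrow> bit \<Rightarrow> nat) \<Rightarrow> 'r::comm_ring_1" where
  "triangle_states A B d n =
    A * (A * (A * d ^ n 0 0 0 + B * d ^ n 1 0 0) + B * (A * d ^ n 0 1 0 + B * d ^ n 1 1 0)) +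
    B * (A * (A * d ^ n 0 0 1 + B * d ^ n 1 0 1) + B * (A * d ^ n 0 1 1 + B * d ^ n 1 1 1))"

text \<open>
  Here \<open>c1, c2, c3\<close> are the row sums in the empty state; in the state \<open>s, t, r\<close> they are
  \<open>c1 + s, c2 + t, c3 + r\<close>. If exactly one of \<open>c1, c2, c3\<close> is 1, the states with row sums \<open>0, 0, 0\<close> and
  \<open>1, 1, 1\<close> have the weights \<open>A^2 B\<close> and \<open>A B^2\<close>, and those with a single row sum 1 have the weights
  \<open>A^3\<close>, \<open>A B^2\<close>, \<open>A B^2\<close>. With \<open>A B = 1\<close> the claim reduces to \<open>A d + A^3 + 2 B = B\<close>. If exactly
  two of \<open>c1, c2, c3\<close> are 1, exchange \<open>A\<close> and \<open>B\<close>.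
\<close>

lemma triangle_states_eq:
  fixes c1 c2 c3 :: bit and A B d :: "'r::comm_ring_1"
  assumes neq: "\<not> (c1 = c2 \<and> c2 = c3)" and AB: "A * B = 1" and d: "d = - A\<^sup>2 - B\<^sup>2"
    and zero: "\<And>s t r. c1 + s = 0 \<Longrightarrow> c2 + t = 0 \<Longrightarrow> c3 + r = 0 \<Longrightarrow> n s t r = Suc x \<and> n' s t r = Suc y"
    and odd: "\<And>s t r. (c1 + s) + (c2 + t) + (c3 + r) = 1 \<Longrightarrow>
      n s t r = (if c1 + s = 1 \<and> c2 + t = 1 then y else x) \<and>
      n' s t r = (if c1 + s = 1 \<and> c2 + t = 1 then x else y)"
    and even: "\<And>s t r. (c1 + s) + (c2 + t) + (c3 + r) = 0 \<Longrightarrow> \<not> (c1 + s = 0 \<and> c2 + t = 0) \<Longrightarrow> n' s t r = n s t r"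
  shows "triangle_states A B d n = triangle_states A B d n'"
proof -
  have d': "d ^ k * d = - (A * (A * d ^ k)) - B * (B * d ^ k)" for k
    unfolding d by (simp add: algebra_simps power2_eq_square)
  have AB': "A * (B * z) = z" "B * (A * z) = z" for z
    using AB by (simp_all add: mult.assoc[symmetric] mult.commute)
  consider "c1 = 1" "c2 = 0" "c3 = 0" | "c1 = 0" "c2 = 1" "c3 = 0" | "c1 = 0" "c2 = 0" "c3 = 1"
    | "c1 = 0" "c2 = 1" "c3 = 1" | "c1 = 1" "c2 = 0" "c3 = 1" | "c1 = 1" "c2 = 1" "c3 = 0"
    using neq by (cases c1; cases c2; cases c3) simp_all
  then show ?thesis
    by cases (simp_all add: triangle_states_def zero odd even power_Suc2 d' AB' distrib_left right_diff_distrib del: power_Suc)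
qed

text \<open>
  The third move for arbitrary blocks whose row sums are not all equal. The six graphs of the move
  only enter through this hypothesis.
\<close>

lemma bracket_toggle_triangle:
  assumes "finite R" "u \<notin> R" "v \<notin> R" "w \<notin> R" "u \<noteq> v" "u \<noteq> w" "v \<noteq> w"
    and "a v u = a u v" "a w u = a u w" "a w v = a v w"
    and "\<And>x. x \<in> R \<Longrightarrow> a w x = a u x + a v x" "\<And>x. x \<in> R \<Longrightarrow> a x w = a x u + a x v"
    and neq: "\<not> (a u u + a u v + a u w = a v v + a u v + a v w \<and>
      a v v + a u v + a v w = a w w + a u w + a v w)"
    and AB: "A * B = 1" and d: "d = - A\<^sup>2 - B\<^sup>2"
  shows "bracket (insert u (insert v (insert w R))) (toggle {u, v, w} a) A B d =
    bracket (insert u (insert v (insert w R))) a A B d"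
proof -
  let ?V = "insert u (insert v (insert w R))" and ?b = "toggle {u, v, w} a"
  define N where "N S t = nullity (insert u (insert v R))
      (pair_form (add_diagonal a S) u v (a u v + a u w) (a u v + a v w) t)" for S t
  \<comment> \<open>The set T S s t r is S with the vertices u, v, w added that are marked by s, t, r.\<close>
  define T where "T S s t r = (if s = 1 then insert u else id) ((if t = 1 then insert v else id)
      ((if r = 1 then insert w else id) S))" for S and s t r :: bit
  have *:
    "a u u + a u v + a u w + s = 0 \<Longrightarrow> a v v + a u v + a v w + t = 0 \<Longrightarrow> a w w + a u w + a v w + r = 0 \<Longrightarrow>
      nullity ?V (add_diagonal a (T S s t r)) = Suc (N S (a u v)) \<and>
      nullity ?V (add_diagonal ?b (T S s t r)) = Suc (N S (a u v + 1))"
    "(a u u + a u v + a u w + s) + (a v v + a u v + a v w + t) + (a w w + a u w + a v w + r) = 1 \<Longrightarrow>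
      nullity ?V (add_diagonal a (T S s t r)) =
        (if a u u + a u v + a u w + s = 1 \<and> a v v + a u v + a v w + t = 1 then N S (a u v + 1) else N S (a u v)) \<and>
      nullity ?V (add_diagonal ?b (T S s t r)) =
        (if a u u + a u v + a u w + s = 1 \<and> a v v + a u v + a v w + t = 1 then N S (a u v) else N S (a u v + 1))"
    "(a u u + a u v + a u w + s) + (a v v + a u v + a v w + t) + (a w w + a u w + a v w + r) = 0 \<Longrightarrow>
      \<not> (a u u + a u v + a u w + s = 0 \<and> a v v + a u v + a v w + t = 0) \<Longrightarrow>
      nullity ?V (add_diagonal ?b (T S s t r)) = nullity ?V (add_diagonal a (T S s t r))"
    if "S \<subseteq> R" for S s t r
  proof -
    let ?m = "add_diagonal a (T S s t r)" and ?m' = "add_diagonal ?b (T S s t r)"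
    have uvw: "u \<notin> S" "v \<notin> S" "w \<notin> S" using that assms by auto
    have T: "u \<in> T S s t r \<longleftrightarrow> s = 1" "v \<in> T S s t r \<longleftrightarrow> t = 1" "w \<in> T S s t r \<longleftrightarrow> r = 1"
      "\<And>x. x \<in> R \<Longrightarrow> x \<in> T S s t r \<longleftrightarrow> x \<in> S"
      unfolding T_def using uvw assms(2-7) by auto
    have bool: "of_bool (k = 1) = k" for k :: bit by (cases k) simp_all
    have m: "?m u u = a u u + s" "?m v v = a v v + t" "?m w w = a w w + r"
      "?m u v = a u v" "?m u w = a u w" "?m v w = a v w" "?m v u = a v u" "?m w u = a w u" "?m w v = a w v"
      using assms(5-7) by (simp_all add: add_diagonal_def T bool)
    have m': "?m' u u = a u u + s" "?m' v v = a v v + t" "?m' w w = a w w + r"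
      "?m' u v = a u v + 1" "?m' u w = a u w + 1" "?m' v w = a v w + 1"
      "?m' v u = a v u + 1" "?m' w u = a w u + 1" "?m' w v = a w v + 1"
      using assms(5-7) by (simp_all add: add_diagonal_def toggle_def T bool)
    have mR: "?m x y = a x y + of_bool (x = y \<and> x \<in> S)" "?m' x y = a x y + of_bool (x = y \<and> x \<in> S)"
      if "x \<in> R \<or> y \<in> R" for x y
      using that assms(2-4) by (auto simp: add_diagonal_def toggle_def T)
    have outer: "\<forall>x\<in>R. ?m w x = ?m u x + ?m v x" "\<forall>x\<in>R. ?m x w = ?m x u + ?m x v"
      "\<forall>x\<in>R. ?m' w x = ?m' u x + ?m' v x" "\<forall>x\<in>R. ?m' x w = ?m' x u + ?m' x v"
      using assms by (auto simp: mR)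
    have two: "x + (y + 1) + (z + 1) = x + y + z" "(y + 1) + (z + 1) = y + z" for x y z :: bit
      by (cases y; cases z; simp)+
    \<comment> \<open>Toggling adds 1 twice to each row of the block, so both forms have the same row sums.\<close>
    have sums: "a u u + a u v + a u w + s = ?m u u + ?m u v + ?m u w"
      "a v v + a u v + a v w + t = ?m v v + ?m u v + ?m v w"
      "a w w + a u w + a v w + r = ?m w w + ?m u w + ?m v w"
      by (simp_all add: m ac_simps)
    have sums': "a u u + a u v + a u w + s = ?m' u u + ?m' u v + ?m' u w"
      "a v v + a u v + a v w + t = ?m' v v + ?m' u v + ?m' v w"
      "a w w + a u w + a v w + r = ?m' w w + ?m' u w + ?m' v w"
      unfolding sums m m' by (simp_all only: two)
    have N: "nullity (insert u (insert v R)) (pair_form ?m u v (a u v + a u w) (a u v + a v w) k) = N S k"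
      "nullity (insert u (insert v R)) (pair_form ?m' u v (a u v + a u w) (a u v + a v w) k) = N S k" for k
      unfolding N_def using assms(2-5) that
      by (intro nullity_cong; auto simp: pair_form_def mR add_diagonal_def toggle_def T)+
    have tog: "?m' = toggle {u, v, w} ?m"
      by (simp add: fun_eq_iff add_diagonal_def toggle_def ac_simps)
    have "?m v u = ?m u v" "?m w u = ?m u w" "?m w v = ?m v w" unfolding m by (fact assms)+
    note G = nullity_insert_triangle[where m = ?m, OF assms(1-7) this outer(1,2) sums,
        unfolded m N, folded tog]
    have "?m' v u = ?m' u v" "?m' w u = ?m' u w" "?m' w v = ?m' v w" unfolding m' using assms(8-10) by simp_all
    note H = nullity_insert_triangle[where m = ?m', OF assms(1-7) this outer(3,4) sums',
        unfolded m' two N]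
    show
      "a u u + a u v + a u w + s = 0 \<Longrightarrow> a v v + a u v + a v w + t = 0 \<Longrightarrow> a w w + a u w + a v w + r = 0 \<Longrightarrow>
        nullity ?V ?m = Suc (N S (a u v)) \<and> nullity ?V ?m' = Suc (N S (a u v + 1))"
      using G(1) H(1) by blast
    have mul: "N S (e + p * q) = (if p = 1 \<and> q = 1 then N S (e + 1) else N S e)"
      "N S (e + 1 + p * q) = (if p = 1 \<and> q = 1 then N S e else N S (e + 1))" for e p q
      by (cases e; cases p; cases q; simp)+
    have cancel: "e + 1 + 1 = e" for e :: bit by (cases e) simp_all
    show "(a u u + a u v + a u w + s) + (a v v + a u v + a v w + t) + (a w w + a u w + a v w + r) = 1 \<Longrightarrow>
      nullity ?V ?m =
        (if a u u + a u v + a u w + s = 1 \<and> a v v + a u v + a v w + t = 1 then N S (a u v + 1) else N S (a u v)) \<and>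
      nullity ?V ?m' =
        (if a u u + a u v + a u w + s = 1 \<and> a v v + a u v + a v w + t = 1 then N S (a u v) else N S (a u v + 1))"
      using G(2) H(2) by (simp only: mul cancel simp_thms)
    show "(a u u + a u v + a u w + s) + (a v v + a u v + a v w + t) + (a w w + a u w + a v w + r) = 0 \<Longrightarrow>
      \<not> (a u u + a u v + a u w + s = 0 \<and> a v v + a u v + a v w + t = 0) \<Longrightarrow>
      nullity ?V ?m' = nullity ?V ?m"
      using G(3) by blast
  qed
  have fin: "finite (insert v (insert w R))" "u \<notin> insert v (insert w R)"
    "finite (insert w R)" "v \<notin> insert w R"
    using assms(1-7) by auto
  show ?thesis
    unfolding bracket_def state_sum_insert[OF fin(1,2)] state_sum_insert[OF fin(3,4)]
      state_sum_insert[OF assms(1,4)]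
  proof (rule state_sum_cong, goal_cases)
    case (1 S)
    have "triangle_states A B d (\<lambda>s t r. nullity ?V (add_diagonal a (T S s t r))) =
        triangle_states A B d (\<lambda>s t r. nullity ?V (add_diagonal ?b (T S s t r)))"
      by (rule triangle_states_eq[OF neq AB d]) (use *[OF 1] in blast)+
    then show ?case by (simp add: triangle_states_def T_def)
  qed
qed

section \<open>Matrices over GF(2)\<close>

text \<open>
  Counting is what links the dimension of a kernel in the sense of linear algebra to the nullity
  above: in terms of a basis, vectors are the functions from the basis to the field.
\<close>

lemma (in vectorspace) card_carrier_eq_power_dim:
  assumes "finite (carrier V)"
  shows "card (carrier V) = card (carrier K) ^ dim"
proof -
  have "gen_set (carrier V)"
    using in_own_span[of "carrier V"] span_is_subset2[of "carrier V"] by blast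
  with assms have "fin_dim" unfolding fin_dim_def by blast
  obtain \<beta> where \<beta>: "finite \<beta>" "basis \<beta>" using finite_basis_exists[OF \<open>fin_dim\<close>] by blast
  then have sub: "\<beta> \<subseteq> carrier V" by (simp add: basis_def)
  have unique: "\<exists>!a. a \<in> \<beta> \<rightarrow>\<^sub>E carrier K \<and> lincomb a \<beta> = v" if "v \<in> carrier V" for v
    using basis_criterion[OF \<beta>(1) sub] \<beta>(2) that by blast
  have "bij_betw (\<lambda>a. lincomb a \<beta>) (\<beta> \<rightarrow>\<^sub>E carrier K) (carrier V)"
  proof (rule bij_betw_imageI)
    have closed: "lincomb a \<beta> \<in> carrier V" if "a \<in> \<beta> \<rightarrow>\<^sub>E carrier K" for a
      using that sub by (intro lincomb_closed) auto
    then show "inj_on (\<lambda>a. lincomb a \<beta>) (\<beta> \<rightarrow>\<^sub>E carrier K)"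
      using unique by (intro inj_onI) blast
    show "(\<lambda>a. lincomb a \<beta>) ` (\<beta> \<rightarrow>\<^sub>E carrier K) = carrier V"
      using unique closed by blast
  qed
  then have "card (carrier V) = card (\<beta> \<rightarrow>\<^sub>E carrier K)" by (simp add: bij_betw_same_card)
  then show ?thesis using \<beta> by (simp add: card_PiE dim_basis)
qed

lemma finite_carrier_vec_bit: "finite (carrier_vec n :: bit vec set)"
proof -
  have "carrier_vec n \<subseteq> vec_of_list ` {xs. set xs \<subseteq> (UNIV :: bit set) \<and> length xs = n}"
  proof
    fix x :: "bit vec" assume "x \<in> carrier_vec n"
    then have "x = vec_of_list (list_of_vec x)" "length (list_of_vec x) = n" by (simp_all add: vec_list)
    then show "x \<in> vec_of_list ` {xs. set xs \<subseteq> (UNIV :: bit set) \<and> length xs = n}" by blast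
  qed
  moreover have "finite (UNIV :: bit set)" by (rule card_ge_0_finite) (simp add: card_UNIV_bit)
  ultimately show ?thesis by (rule finite_subset[OF _ finite_imageI[OF finite_lists_length_eq]])
qed

lemma card_mat_kernel:
  fixes M :: "bit mat"
  shows "card (mat_kernel M) = 2 ^ kernel_dim M"
proof -
  interpret kernel "dim_row M" "dim_col M" M by unfold_locales simp
  have "finite (mat_kernel M)"
    using finite_carrier_vec_bit by (rule finite_subset[rotated]) (auto simp: mat_kernel_def)
  from Ker.card_carrier_eq_power_dim[OF this] show ?thesis
    by (simp add: card_UNIV_bit)
qed

definition diagonal_state :: "'a list \<Rightarrow> 'a set \<Rightarrow> bit mat" where
  "diagonal_state vs S = mat (length vs) (length vs) (\<lambda>(i, j). of_bool (i = j \<and> vs ! i \<in> S))"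

definition form_matrix :: "'a list \<Rightarrow> ('a \<Rightarrow> 'a \<Rightarrow> bit) \<Rightarrow> bit mat" where
  "form_matrix vs m = mat (length vs) (length vs) (\<lambda>(i, j). m (vs ! i) (vs ! j))"

lemma card_kernel_form_matrix:
  assumes "distinct vs"
  shows "card (mat_kernel (form_matrix vs m)) = card (ker (set vs) m)"
proof (rule bij_betw_same_card[of "\<lambda>x. vec (length vs) (\<lambda>i. x (vs ! i))", symmetric])
  let ?f = "\<lambda>x. vec (length vs) (\<lambda>i. x (vs ! i))"
  have sum: "(\<Sum>v\<in>set vs. g v) = (\<Sum>j = 0..<length vs. g (vs ! j))" for g :: "'a \<Rightarrow> bit"
    using sum.reindex_bij_betw[OF bij_betw_nth[OF assms refl refl], of g] by (simp add: atLeast0LessThan)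
  have mem: "?f x \<in> mat_kernel (form_matrix vs m) \<longleftrightarrow> (\<forall>u\<in>set vs. (\<Sum>v\<in>set vs. m u v * x v) = 0)" for x
  proof -
    have "?f x \<in> mat_kernel (form_matrix vs m) \<longleftrightarrow>
        (\<forall>i<length vs. (\<Sum>j = 0..<length vs. m (vs ! i) (vs ! j) * x (vs ! j)) = 0)"
    proof -
      have row: "(form_matrix vs m *\<^sub>v ?f x) $ i = (\<Sum>j = 0..<length vs. m (vs ! i) (vs ! j) * x (vs ! j))"
        if "i < length vs" for i
        using that by (simp add: form_matrix_def scalar_prod_def)
      have "dim_row (form_matrix vs m) = length vs" "dim_col (form_matrix vs m) = length vs"
        by (simp_all add: form_matrix_def)
      then show ?thesis by (simp add: mat_kernel_def vec_eq_iff row del: index_mult_mat_vec)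
    qed
    then show ?thesis by (simp only: sum all_set_conv_all_nth)
  qed
  show "bij_betw ?f (ker (set vs) m) (mat_kernel (form_matrix vs m))"
  proof (rule bij_betw_imageI)
    show "inj_on ?f (ker (set vs) m)"
    proof (rule inj_onI, rule ext)
      fix x y u assume "x \<in> ker (set vs) m" "y \<in> ker (set vs) m" "?f x = ?f y"
      then show "x u = y u"
        by (cases "u \<in> set vs") (auto simp: ker_def supported_def vec_eq_iff in_set_conv_nth)
    qed
    show "?f ` ker (set vs) m = mat_kernel (form_matrix vs m)"
    proof (intro equalityI subsetI)
      fix z assume z: "z \<in> mat_kernel (form_matrix vs m)"
      define x where "x v = (if v \<in> set vs then z $ (THE i. i < length vs \<and> vs ! i = v) else 0)" for v
      have "x (vs ! i) = z $ i" if "i < length vs" for i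
      proof -
        have "(THE j. j < length vs \<and> vs ! j = vs ! i) = i"
          using that assms by (auto simp: nth_eq_iff_index_eq)
        then show ?thesis using that by (simp add: x_def)
      qed
      moreover have "dim_vec z = length vs" using z by (simp add: mat_kernel_def form_matrix_def)
      ultimately have "?f x = z" by (auto simp: vec_eq_iff)
      moreover have "x \<in> supported (set vs)" by (simp add: supported_def x_def)
      ultimately show "z \<in> ?f ` ker (set vs) m"
        using z mem[of x] by (force simp: ker_def)
    qed (auto simp: mem ker_def)
  qed
qed

lemma kernel_dim_form_matrix: "distinct vs \<Longrightarrow> kernel_dim (form_matrix vs m) = nullity (set vs) m"
  using card_kernel_form_matrix[of vs m] card_mat_kernel[of "form_matrix vs m"]
  by (metis floor_log_power nullity_def)


lemma form_matrix_add_diagonal: "form_matrix vs (add_diagonal a S) = form_matrix vs a + diagonal_state vs S"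
  if "distinct vs"
  using that
  by (intro eq_matI) (simp_all add: form_matrix_def diagonal_state_def add_diagonal_def nth_eq_iff_index_eq)

lemma diagonal_state_eq_form_matrix:
  "distinct vs \<Longrightarrow> diagonal_state vs S = form_matrix vs (\<lambda>u v. of_bool (u = v \<and> u \<in> S))"
  by (intro eq_matI) (simp_all add: form_matrix_def diagonal_state_def nth_eq_iff_index_eq)

lemma card_supported:
  fixes V :: "'a set"
  shows "finite V \<Longrightarrow> card (supported V) = 2 ^ card V"
proof (induction V rule: finite_induct)
  case empty
  have "supported {} = {\<lambda>_ :: 'a. 0 :: bit}" by (auto simp: supported_def)
  then show ?case by simp
next
  case (insert v V)
  have "card (supported (insert v V)) = card {x \<in> supported (insert v V). True}" by simp
  also have "\<dots> = card ((UNIV :: bit set) \<times> supported V)"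
    unfolding card_supported_insert[OF \<open>v \<notin> V\<close>] by (intro arg_cong[where f = card]) auto
  finally show ?case using insert by (simp add: card_cartesian_product card_UNIV_bit)
qed

lemma kernel_dim_diagonal_state:
  assumes "distinct vs" "S \<subseteq> set vs"
  shows "kernel_dim (diagonal_state vs S) = card (set vs - S)"
proof -
  have "ker (set vs) (\<lambda>u v. of_bool (u = v \<and> u \<in> S)) = supported (set vs - S)"
    using assms(2) by (auto simp: ker_def supported_def of_bool_conj sum.delta if_distrib split: if_splits)
  then show ?thesis
    using assms(1) by (simp add: diagonal_state_eq_form_matrix kernel_dim_form_matrix nullity_def card_supported)
qed

lemma diagonal_state_mult_vec:
  assumes "x \<in> carrier_vec (length vs)"
  shows "diagonal_state vs S *\<^sub>v x = vec (length vs) (\<lambda>i. of_bool (vs ! i \<in> S) * x $ i)"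
proof (rule eq_vecI)
  fix i assume "i < dim_vec (vec (length vs) (\<lambda>i. of_bool (vs ! i \<in> S) * x $ i))"
  then have i: "i < length vs" by simp
  have "(diagonal_state vs S *\<^sub>v x) $ i = (\<Sum>j = 0..<length vs. of_bool (i = j \<and> vs ! i \<in> S) * x $ j)"
    using i assms by (simp add: diagonal_state_def scalar_prod_def)
  also have "\<dots> = (\<Sum>j = 0..<length vs. if i = j then of_bool (vs ! i \<in> S) * x $ j else 0)"
    by (rule sum.cong) auto
  finally show "(diagonal_state vs S *\<^sub>v x) $ i = vec (length vs) (\<lambda>i. of_bool (vs ! i \<in> S) * x $ i) $ i"
    using i by simp
qed (simp add: diagonal_state_def)

text \<open>
  The column space of a diagonal 0-1 matrix consists of the vectors that vanish at the zeros of the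
  diagonal. This is the kernel of the complementary diagonal matrix, so that its dimension is
  obtained from that of a kernel.
\<close>

lemma rank_diagonal_state:
  assumes "distinct vs" "S \<subseteq> set vs"
  shows "vec_space.rank (length vs) (diagonal_state vs S) = card S"
proof -
  let ?n = "length vs" and ?D = "diagonal_state vs S" and ?D' = "diagonal_state vs (set vs - S)"
  interpret vec_space "TYPE(bit)" ?n .
  have D: "?D \<in> carrier_mat ?n ?n" by (simp add: diagonal_state_def)
  then have cols: "set (cols ?D) \<subseteq> carrier_vec ?n" using cols_dim[of ?D] by simp
  interpret W: vectorspace class_ring "span_vs (set (cols ?D))"
    using span_is_subspace[OF cols] by (rule subspace_is_vs)
  have "span (set (cols ?D)) = {y \<in> carrier_vec ?n. \<exists>x\<in>carrier_vec ?n. ?D *\<^sub>v x = y}"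
    using col_space_eq[OF D] D unfolding col_space_def by auto
  also have "\<dots> = {y \<in> carrier_vec ?n. ?D' *\<^sub>v y = 0\<^sub>v ?n}"
  proof (rule Collect_cong, rule conj_cong[OF refl])
    fix y :: "bit vec" assume y: "y \<in> carrier_vec ?n"
    show "(\<exists>x\<in>carrier_vec ?n. ?D *\<^sub>v x = y) \<longleftrightarrow> ?D' *\<^sub>v y = 0\<^sub>v ?n"
    proof
      assume "\<exists>x\<in>carrier_vec ?n. ?D *\<^sub>v x = y"
      then obtain x where x: "x \<in> carrier_vec ?n" and "y = ?D *\<^sub>v x" by blast
      then have "y = vec ?n (\<lambda>i. of_bool (vs ! i \<in> S) * x $ i)"
        by (simp add: diagonal_state_mult_vec)
      then show "?D' *\<^sub>v y = 0\<^sub>v ?n"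
        by (intro eq_vecI) (simp_all add: diagonal_state_mult_vec)
    next
      assume "?D' *\<^sub>v y = 0\<^sub>v ?n"
      then have "?D *\<^sub>v y = y"
        using y by (auto simp: diagonal_state_mult_vec vec_eq_iff split: if_splits)
      then show "\<exists>x\<in>carrier_vec ?n. ?D *\<^sub>v x = y" using y by blast
    qed
  qed
  also have "\<dots> = mat_kernel ?D'" by (auto simp: mat_kernel_def diagonal_state_def)
  finally have span: "span (set (cols ?D)) = mat_kernel ?D'" .
  have "set vs - (set vs - S) = S" using assms(2) by auto
  then have "card (span (set (cols ?D))) = 2 ^ card S"
    unfolding span using assms(1) by (simp add: card_mat_kernel kernel_dim_diagonal_state)
  moreover have "finite (span (set (cols ?D)))"
    by (rule finite_subset[OF _ finite_carrier_vec_bit]) (use span_closed[OF cols] in blast)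
  ultimately have "W.dim = card S"
    using W.card_carrier_eq_power_dim by (simp add: card_UNIV_bit)
  then show ?thesis by (simp add: rank_def)
qed

text \<open>
  The right-hand side does not mention an enumeration of the vertices, which makes induced subgraphs,
  and hence the moves, accessible.
\<close>

lemma graph_bracket_eq_bracket:
  assumes "pair_pseudo_graph G"
  shows "graph_bracket G A B d = bracket (pverts G) (\<lambda>u v. of_bool ((u, v) \<in> parcs G)) A B d"
proof -
  let ?vs = "vertex_list G" and ?a = "\<lambda>u v. of_bool ((u, v) \<in> parcs G) :: bit"
  note vs = vertex_list[OF assms]
  have n: "card (pverts G) = length ?vs" using vs by (metis distinct_card)
  have adj: "adjacency_matrix G = form_matrix ?vs ?a"
    by (simp add: adjacency_matrix_def form_matrix_def Let_def)
  have inj: "inj_on (diagonal_state ?vs) (Pow (pverts G))"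
  proof (rule inj_onI)
    fix S S' assume S: "S \<in> Pow (pverts G)" "S' \<in> Pow (pverts G)" and eq: "diagonal_state ?vs S = diagonal_state ?vs S'"
    have "?vs ! i \<in> S \<longleftrightarrow> ?vs ! i \<in> S'" if "i < length ?vs" for i
      using arg_cong[OF eq, of "\<lambda>M. M $$ (i, i)"] that by (simp add: diagonal_state_def of_bool_eq_iff)
    then show "S = S'" using S vs(2) by (metis Pow_iff in_set_conv_nth subset_antisym subset_iff)
  qed
  have img: "{D \<in> carrier_mat (length ?vs) (length ?vs). diagonal_mat D} = diagonal_state ?vs ` Pow (pverts G)"
  proof (intro equalityI subsetI)
    fix D :: "bit mat" assume D: "D \<in> {D \<in> carrier_mat (length ?vs) (length ?vs). diagonal_mat D}"
    define S where "S = {?vs ! i | i. i < length ?vs \<and> D $$ (i, i) = 1}"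
    have S: "?vs ! i \<in> S \<longleftrightarrow> D $$ (i, i) = 1" if "i < length ?vs" for i
      using that vs(1) by (auto simp: S_def nth_eq_iff_index_eq)
    have "D = diagonal_state ?vs S"
    proof (rule eq_matI)
      fix i j assume "i < dim_row (diagonal_state ?vs S)" "j < dim_col (diagonal_state ?vs S)"
      then show "D $$ (i, j) = diagonal_state ?vs S $$ (i, j)"
        using D S[of i] by (cases "i = j") (auto simp: diagonal_state_def diagonal_mat_def)
    qed (use D in \<open>auto simp: diagonal_state_def\<close>)
    moreover have "S \<in> Pow (pverts G)" unfolding S_def vs(2)[symmetric] by auto
    ultimately show "D \<in> diagonal_state ?vs ` Pow (pverts G)" by blast
  next
    fix D assume "D \<in> diagonal_state ?vs ` Pow (pverts G)"
    then obtain S where "D = diagonal_state ?vs S" by blast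
    then show "D \<in> {D \<in> carrier_mat (length ?vs) (length ?vs). diagonal_mat D}"
      by (simp add: diagonal_state_def diagonal_mat_def)
  qed
  show ?thesis
    unfolding graph_bracket_def Let_def n img sum.reindex[OF inj]
      bracket_def state_sum_def
    using vs by (intro sum.cong) (simp_all add: kernel_dim_diagonal_state rank_diagonal_state adj
        form_matrix_add_diagonal[symmetric] kernel_dim_form_matrix)
qed

abbreviation adjacency :: "'a pair_pre_digraph \<Rightarrow> 'a \<Rightarrow> 'a \<Rightarrow> bit" where
  "adjacency G u v \<equiv> of_bool ((u, v) \<in> parcs G)"

section \<open>Isomorphisms of graphs\<close>

lemma pair_pseudo_graph_iff:
  "pair_pseudo_graph G \<longleftrightarrow> finite (pverts G) \<and> parcs G \<subseteq> pverts G \<times> pverts G \<and> sym (parcs G)"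
proof
  assume "pair_pseudo_graph G"
  then interpret pair_pseudo_graph G .
  show "finite (pverts G) \<and> parcs G \<subseteq> pverts G \<times> pverts G \<and> sym (parcs G)"
    using pair_finite_verts arcs_symmetric by (auto intro: symI dest: in_arcsD1 in_arcsD2)
next
  assume *: "finite (pverts G) \<and> parcs G \<subseteq> pverts G \<times> pverts G \<and> sym (parcs G)"
  then have "finite (parcs G)" by (meson finite_SigmaI finite_subset)
  with * show "pair_pseudo_graph G"
    by unfold_locales (auto simp: symmetric_def)
qed

text \<open>
  Since head and tail of an arc are its components, the map on arcs that is part of an isomorphism is
  determined by the map on vertices.
\<close>

lemma digraph_iso_with_projE:
  assumes "digraph_iso (with_proj G) (with_proj H)"
  obtains f where "inj_on f (pverts G)" "pverts H = f ` pverts G" "parcs H = map_prod f f ` parcs G"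
    "parcs G \<subseteq> pverts G \<times> pverts G"
proof -
  obtain h where h: "pre_digraph.digraph_isomorphism (with_proj G) h" "with_proj H = app_iso h (with_proj G)"
    using assms by (auto simp: digraph_iso_def)
  from h(1) have wf: "wf_digraph (with_proj G)" and inj: "inj_on (iso_verts h) (pverts G)"
    and ends: "\<And>a. a \<in> parcs G \<Longrightarrow> iso_verts h (fst a) = iso_tail h (iso_arcs h a) \<and>
      iso_verts h (snd a) = iso_head h (iso_arcs h a)"
    by (auto simp: pre_digraph.digraph_isomorphism_def)
  have "pverts H = iso_verts h ` pverts G" "parcs H = iso_arcs h ` parcs G" "iso_tail h = fst" "iso_head h = snd"
    using arg_cong[OF h(2), of verts] arg_cong[OF h(2), of arcs] arg_cong[OF h(2), of tail]
      arg_cong[OF h(2), of head] by simp_all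
  moreover from this ends have "iso_arcs h a = map_prod (iso_verts h) (iso_verts h) a" if "a \<in> parcs G" for a
    using that by (simp add: prod_eq_iff)
  moreover have "parcs G \<subseteq> pverts G \<times> pverts G"
    using wf_digraph.tail_in_verts[OF wf] wf_digraph.head_in_verts[OF wf] by (auto simp: mem_Times_iff)
  ultimately show thesis using that[of "iso_verts h"] inj by (simp cong: image_cong)
qed

lemma mem_arcs_image_iff:
  assumes "inj_on f V" "E \<subseteq> V \<times> V" "x \<in> V" "y \<in> V"
  shows "(f x, f y) \<in> map_prod f f ` E \<longleftrightarrow> (x, y) \<in> E"
proof
  assume "(f x, f y) \<in> map_prod f f ` E"
  then obtain a b where "(a, b) \<in> E" "f x = f a" "f y = f b" by auto
  moreover from this have "a \<in> V" "b \<in> V" using assms(2) by auto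
  ultimately show "(x, y) \<in> E" using assms by (metis inj_onD)
qed force

lemma pair_pseudo_graph_iso:
  assumes "pair_pseudo_graph G" "digraph_iso (with_proj G) (with_proj H)"
  shows "pair_pseudo_graph H"
proof -
  obtain f where "pverts H = f ` pverts G" "parcs H = map_prod f f ` parcs G"
    by (rule digraph_iso_with_projE[OF assms(2)])
  with assms(1) show ?thesis
    by (fastforce simp: pair_pseudo_graph_iff sym_def)
qed

text \<open>
  With respect to an enumeration of \<open>V\<close> and its image under \<open>f\<close> the two forms have the same matrix.
\<close>

lemma nullity_image:
  assumes "finite V" "\<And>x y. x \<in> V \<Longrightarrow> y \<in> V \<Longrightarrow> m' (f x) (f y) = m x y" "inj_on f V"
  shows "nullity (f ` V) m' = nullity V m"
proof -
  obtain vs where vs: "distinct vs" "set vs = V" using finite_distinct_list[OF assms(1)] by blast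
  have "form_matrix (map f vs) m' = form_matrix vs m"
    using assms(2) vs(2) by (intro eq_matI) (auto simp: form_matrix_def)
  moreover have "distinct (map f vs)" using vs assms(3) by (simp add: distinct_map)
  ultimately show ?thesis
    using vs kernel_dim_form_matrix[of vs m] kernel_dim_form_matrix[of "map f vs" m'] by simp
qed

lemma bracket_image:
  assumes "finite V" "\<And>x y. x \<in> V \<Longrightarrow> y \<in> V \<Longrightarrow> a' (f x) (f y) = a x y" and inj: "inj_on f V"
  shows "bracket (f ` V) a' A B d = bracket V a A B d"
proof -
  have "A ^ card (f ` V - f ` S) * B ^ card (f ` S) * d ^ nullity (f ` V) (add_diagonal a' (f ` S)) =
      A ^ card (V - S) * B ^ card S * d ^ nullity V (add_diagonal a S)" if "S \<subseteq> V" for S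
  proof -
    have "f ` V - f ` S = f ` (V - S)" "inj_on f (V - S)" "inj_on f S"
      using inj that by (auto simp: inj_on_image_set_diff intro: inj_on_subset)
    moreover have "nullity (f ` V) (add_diagonal a' (f ` S)) = nullity V (add_diagonal a S)"
    proof (rule nullity_image[OF assms(1) _ inj])
      fix x y assume "x \<in> V" "y \<in> V"
      moreover from this have "f x = f y \<longleftrightarrow> x = y" "f x \<in> f ` S \<longleftrightarrow> x \<in> S"
        using inj that by (auto dest: inj_onD)
      ultimately show "add_diagonal a' (f ` S) (f x) (f y) = add_diagonal a S x y"
        by (simp add: add_diagonal_def assms(2))
    qed
    ultimately show ?thesis by (simp add: card_image)
  qed
  moreover have "Pow (f ` V) = image f ` Pow V" by (simp add: image_Pow_surj)
  ultimately show ?thesis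
    unfolding bracket_def state_sum_def
    by (simp add: sum.reindex[OF inj_on_image_Pow[OF inj]])
qed

section \<open>Laurent polynomials\<close>

lemma map_key_uminus_single: "Poly_Mapping.map_key uminus (Poly_Mapping.single k c) = Poly_Mapping.single (- k) c"
  for k :: int
  using map_key_single[of uminus "- k" c] by simp

text \<open>
  Negating the exponents is the substitution of \<open>1/t\<close> for \<open>t\<close>, which is multiplicative. For a monomial
  as one factor, this moves the factor contributed by the first move out of the bracket.
\<close>

lemma map_key_uminus_single_mult:
  "Poly_Mapping.map_key uminus (Poly_Mapping.single k c * p) =
    Poly_Mapping.single (- k) c * Poly_Mapping.map_key uminus p" for p :: laurent
proof (induction p rule: update_induct)
  case const
  show ?case by simp
next
  case (update p a b)
  have "Poly_Mapping.update a b p = Poly_Mapping.single a b + p"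
    using update(1) by (intro poly_mapping_eqI) (auto simp: lookup_update lookup_add lookup_single in_keys_iff)
  then show ?case
    using update(3) by (simp add: distrib_left map_key_plus mult_single map_key_uminus_single)
qed

abbreviation laurent_A :: laurent where "laurent_A \<equiv> Poly_Mapping.single 1 1"
abbreviation laurent_B :: laurent where "laurent_B \<equiv> Poly_Mapping.single (-1) 1"
abbreviation laurent_d :: laurent where "laurent_d \<equiv> - laurent_A\<^sup>2 - laurent_B\<^sup>2"

lemma laurent_A_B: "laurent_A * laurent_B = 1"
  by (simp add: mult_single)

lemma unlooped_factor: "laurent_A * laurent_d + laurent_B = Poly_Mapping.single 3 (- 1)"
  by (simp add: power2_eq_square mult_single single_uminus right_diff_distrib)

lemma looped_factor: "laurent_A + laurent_B * laurent_d = Poly_Mapping.single (- 3) (- 1)"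
  by (simp add: power2_eq_square mult_single single_uminus right_diff_distrib)

section \<open>Invariance of the Jones polynomial\<close>

definition loops :: "'a pair_pre_digraph \<Rightarrow> 'a set" where
  "loops G = {v \<in> pverts G. (v, v) \<in> parcs G}"

lemma jones_polynomial_eq:
  assumes "pair_pseudo_graph G"
  shows "jones_polynomial G = (-1) ^ card (pverts G) *
    Poly_Mapping.single (3 * int (card (pverts G)) - 6 * int (card (loops G))) 1 *
    Poly_Mapping.map_key uminus (bracket (pverts G) (adjacency G) laurent_A laurent_B laurent_d)"
  by (simp add: jones_polynomial_def reduced_bracket_def Let_def loops_def graph_bracket_eq_bracket[OF assms])

lemma jones_polynomial_iso:
  assumes "pair_pseudo_graph G" "digraph_iso (with_proj G) (with_proj H)"
  shows "jones_polynomial G = jones_polynomial H"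
proof -
  obtain f where f: "inj_on f (pverts G)" "pverts H = f ` pverts G" "parcs H = map_prod f f ` parcs G"
    and G: "parcs G \<subseteq> pverts G \<times> pverts G"
    by (rule digraph_iso_with_projE[OF assms(2)])
  note iff = mem_arcs_image_iff[OF f(1) G, folded f(3)]
  have "loops H = f ` loops G" unfolding loops_def f(2) using iff by auto
  moreover have "inj_on f (loops G)" using f(1) by (rule inj_on_subset) (auto simp: loops_def)
  ultimately have "card (loops H) = card (loops G)" by (simp add: card_image)
  moreover have "card (pverts H) = card (pverts G)" using f(1,2) by (simp add: card_image)
  moreover have "bracket (pverts H) (adjacency H) laurent_A laurent_B laurent_d =
      bracket (pverts G) (adjacency G) laurent_A laurent_B laurent_d"
    unfolding f(2) using assms(1) f(1) iff by (intro bracket_image) (simp_all add: pair_pseudo_graph_iff)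
  ultimately show ?thesis
    unfolding jones_polynomial_eq[OF assms(1)] jones_polynomial_eq[OF pair_pseudo_graph_iso[OF assms]]
    by (simp only:)
qed

lemma pair_graph_restrictD:
  assumes "with_proj H = with_proj G \<restriction> S"
  shows "pverts H = S" "parcs H = {(x, y) \<in> parcs G. x \<in> S \<and> y \<in> S}"
proof -
  show "pverts H = S" using arg_cong[OF assms, of verts] by simp
  have "{e \<in> parcs G. fst e \<in> S \<and> snd e \<in> S} = {(x, y) \<in> parcs G. x \<in> S \<and> y \<in> S}"
    by (rule Set.set_eqI) (simp add: case_prod_beta)
  with arg_cong[OF assms, of arcs] show "parcs H = {(x, y) \<in> parcs G. x \<in> S \<and> y \<in> S}"
    by simp
qed

lemma bracket_restrict:
  assumes "with_proj H = with_proj G \<restriction> S"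
  shows "bracket S (adjacency H) A B d = bracket S (adjacency G) A B d"
  by (rule bracket_cong) (simp add: pair_graph_restrictD(2)[OF assms])

lemma jones_polynomial_omega1:
  assumes G: "pair_pseudo_graph G" and H: "pair_pseudo_graph H" and "omega1 G H"
  shows "jones_polynomial G = jones_polynomial H"
proof -
  obtain v where v: "v \<in> pverts G" "\<And>x. x \<in> pverts G - {v} \<Longrightarrow> (x, v) \<notin> parcs G"
    and restr: "with_proj H = with_proj G \<restriction> (pverts G - {v})"
    using \<open>omega1 G H\<close> by (auto simp: omega1_def)
  let ?R = "pverts G - {v}"
  have fin: "finite ?R" "finite (pverts G)" and sym: "sym (parcs G)" using G by (auto simp: pair_pseudo_graph_iff)
  have V: "pverts G = insert v ?R" using v by auto
  have nadj: "adjacency G v x = 0" "adjacency G x v = 0" if "x \<in> ?R" for x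
    using v(2)[OF that] sym by (auto dest: symD)
  have bracket: "bracket (pverts G) (adjacency G) laurent_A laurent_B laurent_d =
      Poly_Mapping.single (if (v, v) \<in> parcs G then - 3 else 3) (- 1) *
      bracket (pverts H) (adjacency H) laurent_A laurent_B laurent_d"
    unfolding pair_graph_restrictD(1)[OF restr] bracket_restrict[OF restr]
    by (subst V, subst bracket_insert_isolated) (use fin nadj unlooped_factor looped_factor in simp_all)
  have card: "card (pverts G) = Suc (card (pverts H))"
    unfolding pair_graph_restrictD(1)[OF restr] using v fin by (metis card.remove)
  have "loops G = (if (v, v) \<in> parcs G then insert v (loops H) else loops H)" "v \<notin> loops H" "finite (loops H)"
    unfolding loops_def pair_graph_restrictD[OF restr] using v fin by auto
  then have loops: "int (card (loops G)) = int (card (loops H)) + of_bool ((v, v) \<in> parcs G)"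
    by simp
  have "(-1) ^ Suc n * Poly_Mapping.single (3 * int (Suc n) - 6 * (l + of_bool P)) 1 *
      (Poly_Mapping.single (- (if P then - 3 else 3)) (- 1) * p) =
      (-1) ^ n * Poly_Mapping.single (3 * int n - 6 * l) 1 * p" for n l P and p :: laurent
  proof -
    have "Poly_Mapping.single (3 * int (Suc n) - 6 * (l + of_bool P)) 1 *
        Poly_Mapping.single (- (if P then - 3 else 3)) (- 1) =
        - Poly_Mapping.single (3 * int n - 6 * l) (1 :: int)"
      by (cases P) (simp_all add: mult_single single_uminus)
    then have "(-1) ^ Suc n * (Poly_Mapping.single (3 * int (Suc n) - 6 * (l + of_bool P)) 1 *
        Poly_Mapping.single (- (if P then - 3 else 3)) (- 1)) * p =
        (-1) ^ n * Poly_Mapping.single (3 * int n - 6 * l) 1 * p"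
      by simp
    then show ?thesis by (simp only: mult.assoc)
  qed
  then show ?thesis
    unfolding jones_polynomial_eq[OF G] jones_polynomial_eq[OF H] bracket map_key_uminus_single_mult card loops .
qed

text \<open>
  The move removes two vertices and one loop, so neither the sign nor the exponent \<open>3 n - 6 l\<close> changes.
\<close>

lemma jones_polynomial_omega2:
  assumes G: "pair_pseudo_graph G" and H: "pair_pseudo_graph H" and "omega2 G H"
  shows "jones_polynomial G = jones_polynomial H"
proof -
  obtain v w where vw: "v \<in> pverts G" "w \<in> pverts G" "v \<noteq> w" "(v, v) \<in> parcs G" "(w, w) \<notin> parcs G"
    "\<And>x. x \<in> pverts G - {v, w} \<Longrightarrow> (x, v) \<in> parcs G \<longleftrightarrow> (x, w) \<in> parcs G"
    and restr: "with_proj H = with_proj G \<restriction> (pverts G - {v, w})"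
    using \<open>omega2 G H\<close> by (auto simp: omega2_def)
  let ?R = "pverts G - {v, w}"
  have fin: "finite ?R" "finite (pverts G)" and sym: "\<And>x y. (x, y) \<in> parcs G \<longleftrightarrow> (y, x) \<in> parcs G"
    using G by (auto simp: pair_pseudo_graph_iff dest: symD)
  have V: "pverts G = insert v (insert w ?R)" using vw by auto
  have bracket: "bracket (pverts G) (adjacency G) laurent_A laurent_B laurent_d =
      bracket (pverts H) (adjacency H) laurent_A laurent_B laurent_d"
    unfolding pair_graph_restrictD(1)[OF restr] bracket_restrict[OF restr]
    by (subst V, rule bracket_insert_parallel) (use fin vw sym laurent_A_B in auto)
  have card: "card (pverts G) = Suc (Suc (card (pverts H)))"
    unfolding pair_graph_restrictD(1)[OF restr] using vw(3) fin by (subst V) simp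
  have "loops G = insert v (loops H)" "v \<notin> loops H" "finite (loops H)"
    unfolding loops_def pair_graph_restrictD[OF restr] using vw fin by auto
  then have loops: "int (card (loops G)) = int (card (loops H)) + 1" by simp
  show ?thesis
    unfolding jones_polynomial_eq[OF G] jones_polynomial_eq[OF H] bracket card loops
    by simp
qed

text \<open>
  For a path with middle vertex 1 the row sums of the adjacency matrix at 0, 1, 2 are \<open>1, 0, 1\<close> plus
  the loops; for a triangle they are just the loops.
\<close>

lemma omega3_graph_row_sums:
  assumes "K \<in> omega3_graphs"
  shows "\<exists>x\<in>pverts K. \<exists>y\<in>pverts K. (\<Sum>z\<in>pverts K. adjacency K x z) \<noteq> (\<Sum>z\<in>pverts K. adjacency K y z)"
  using assms unfolding omega3_graphs_def Let_def three_vertex_graph_def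
  by (elim insertE emptyE) (simp_all add: Id_on_iff del: sum_of_bool_eq)

lemma induced_omega3_graph_row_sums:
  assumes "K \<in> omega3_graphs" "digraph_iso (with_proj K) (with_proj G \<restriction> T)"
  shows "\<exists>x\<in>T. \<exists>y\<in>T. (\<Sum>z\<in>T. adjacency G x z) \<noteq> (\<Sum>z\<in>T. adjacency G y z)"
proof -
  let ?H = "\<lparr>pverts = T, parcs = {(x, y) \<in> parcs G. x \<in> T \<and> y \<in> T}\<rparr>"
  have "with_proj G \<restriction> T = with_proj ?H"
    by (auto simp: with_proj_def induce_subgraph_def)
  then obtain f where f: "inj_on f (pverts K)" "T = f ` pverts K"
    "{(x, y) \<in> parcs G. x \<in> T \<and> y \<in> T} = map_prod f f ` parcs K" and K: "parcs K \<subseteq> pverts K \<times> pverts K"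
    using digraph_iso_with_projE[of K ?H] assms(2) by auto
  have row: "(\<Sum>z\<in>T. adjacency G (f x) z) = (\<Sum>z\<in>pverts K. adjacency K x z)" if "x \<in> pverts K" for x
  proof -
    have "(f x, f z) \<in> parcs G \<longleftrightarrow> (x, z) \<in> parcs K" if "z \<in> pverts K" for z
      using mem_arcs_image_iff[OF f(1) K \<open>x \<in> pverts K\<close> that] that \<open>x \<in> pverts K\<close> f(2)
      unfolding f(3)[symmetric] by auto
    then have "(\<Sum>z\<in>pverts K. adjacency G (f x) (f z)) = (\<Sum>z\<in>pverts K. adjacency K x z)"
      by (intro sum.cong) (simp_all only:)
    then show ?thesis by (simp only: f(2) sum.reindex[OF f(1)] comp_def)
  qed
  obtain x y where xy: "x \<in> pverts K" "y \<in> pverts K"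
    "(\<Sum>z\<in>pverts K. adjacency K x z) \<noteq> (\<Sum>z\<in>pverts K. adjacency K y z)"
    using omega3_graph_row_sums[OF assms(1)] by blast
  show ?thesis
  proof (intro bexI)
    show "(\<Sum>z\<in>T. adjacency G (f x) z) \<noteq> (\<Sum>z\<in>T. adjacency G (f y) z)"
      using xy(3) by (simp only: row[OF xy(1)] row[OF xy(2)] not_False_eq_True)
    show "f x \<in> T" "f y \<in> T" using xy(1,2) by (simp_all only: f(2) imageI)
  qed
qed

lemma jones_polynomial_omega3:
  assumes G: "pair_pseudo_graph G" and H: "pair_pseudo_graph H" and "omega3 G H"
  shows "jones_polynomial G = jones_polynomial H"
proof -
  from \<open>omega3 G H\<close> obtain u v w K where uvw: "u \<in> pverts G" "v \<in> pverts G" "w \<in> pverts G"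
    and ne: "u \<noteq> v" "v \<noteq> w" "u \<noteq> w"
    and outer: "\<forall>x \<in> pverts G - {u, v, w}. (\<exists>y \<in> {u, v, w}. (x, y) \<in> parcs G) \<longrightarrow>
      card {y \<in> {u, v, w}. (x, y) \<in> parcs G} = 2"
    and K: "K \<in> omega3_graphs" "digraph_iso (with_proj K) (with_proj G \<restriction> {u, v, w}) \<or>
      digraph_iso (with_proj K) (with_proj H \<restriction> {u, v, w})"
    and H_def: "pverts H = pverts G"
      "parcs H = sym_diff (parcs G) {(x, y). x \<in> {u, v, w} \<and> y \<in> {u, v, w} \<and> x \<noteq> y}"
    unfolding omega3_def by (elim bexE conjE) (rule that)
  let ?R = "pverts G - {u, v, w}" and ?a = "adjacency G"
  have fin: "finite ?R" and sym: "\<And>x y. (x, y) \<in> parcs G \<longleftrightarrow> (y, x) \<in> parcs G"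
    using G by (auto simp: pair_pseudo_graph_iff dest: symD)
  have V: "pverts G = insert u (insert v (insert w ?R))" using uvw by auto
  have toggle_apply: "adjacency H x y = toggle {u, v, w} ?a x y" for x y
    unfolding H_def(2) toggle_def by auto
  then have toggle: "adjacency H = toggle {u, v, w} ?a" by (intro ext)
  \<comment> \<open>Being adjacent to none or exactly two of u, v, w means that the three entries have even sum.\<close>
  have row: "?a x w = ?a x u + ?a x v" if "x \<in> ?R" for x
  proof -
    have "card {y \<in> {u, v, w}. (x, y) \<in> parcs G} = (\<Sum>y\<in>{u, v, w}. of_bool ((x, y) \<in> parcs G))"
      by (subst sum_of_bool_eq) (simp_all add: Int_def)
    also have "\<dots> = of_bool ((x, u) \<in> parcs G) + of_bool ((x, v) \<in> parcs G) + of_bool ((x, w) \<in> parcs G)"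
      using ne by (simp del: sum_of_bool_eq)
    finally have "card {y \<in> {u, v, w}. (x, y) \<in> parcs G} =
      of_bool ((x, u) \<in> parcs G) + of_bool ((x, v) \<in> parcs G) + of_bool ((x, w) \<in> parcs G)" .
    then show ?thesis using bspec[OF outer that]
      by (cases "(x, u) \<in> parcs G"; cases "(x, v) \<in> parcs G"; cases "(x, w) \<in> parcs G") simp_all
  qed
  have sums: "(\<Sum>z\<in>{u, v, w}. m z) = m u + m v + m w" for m :: "'a \<Rightarrow> bit"
    using ne by (simp add: add.assoc)
  have two: "x + (y + 1) + (z + 1) = x + y + z" "(x + 1) + y + (z + 1) = x + y + z"
    "(x + 1) + (y + 1) + z = x + y + z" for x y z :: bit
    by (cases x; cases y; cases z; simp)+
  \<comment> \<open>Toggling changes two entries in each row of the block.\<close>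
  have row_H: "(\<Sum>z\<in>{u, v, w}. adjacency H x z) = (\<Sum>z\<in>{u, v, w}. ?a x z)" if "x \<in> {u, v, w}" for x
    using that ne unfolding sums toggle_apply by (elim insertE emptyE) (simp_all add: toggle_def two)
  have "\<exists>x\<in>{u, v, w}. \<exists>y\<in>{u, v, w}. (\<Sum>z\<in>{u, v, w}. ?a x z) \<noteq> (\<Sum>z\<in>{u, v, w}. ?a y z)"
    using K(2)
  proof
    assume "digraph_iso (with_proj K) (with_proj G \<restriction> {u, v, w})"
    with K(1) show ?thesis by (rule induced_omega3_graph_row_sums)
  next
    assume "digraph_iso (with_proj K) (with_proj H \<restriction> {u, v, w})"
    with K(1) obtain x y where "x \<in> {u, v, w}" "y \<in> {u, v, w}"
      "(\<Sum>z\<in>{u, v, w}. adjacency H x z) \<noteq> (\<Sum>z\<in>{u, v, w}. adjacency H y z)"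
      using induced_omega3_graph_row_sums by blast
    then show ?thesis using row_H by metis
  qed
  then have neq: "\<not> (?a u u + ?a u v + ?a u w = ?a v v + ?a u v + ?a v w \<and>
      ?a v v + ?a u v + ?a v w = ?a w w + ?a u w + ?a v w)"
    unfolding sums using sym[of v u] sym[of w u] sym[of w v] by (auto simp: ac_simps)
  have "bracket (pverts H) (adjacency H) laurent_A laurent_B laurent_d =
      bracket (pverts G) ?a laurent_A laurent_B laurent_d"
    unfolding H_def(1) toggle
    by (subst (1 2) V, rule bracket_toggle_triangle) (use fin ne neq row sym laurent_A_B in auto)
  moreover have "loops H = loops G" unfolding loops_def H_def by auto
  ultimately show ?thesis
    unfolding jones_polynomial_eq[OF G] jones_polynomial_eq[OF H] by (simp add: H_def(1))
qed

theorem theorem3: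
  fixes G :: "'a pair_pre_digraph" and G' :: "'b pair_pre_digraph"
  assumes "pair_pseudo_graph G" and "pair_pseudo_graph G'"
    and "reidemeister_equivalent G G'"
  shows "jones_polynomial G = jones_polynomial G'"
proof -
  obtain H H' :: "nat pair_pre_digraph" where H: "digraph_iso (with_proj G) (with_proj H)"
    and equiv: "equivclp reidemeister_step H H'" and H': "digraph_iso (with_proj H') (with_proj G')"
    using assms(3) by (auto simp: reidemeister_equivalent_def)
  have invariant: "jones_polynomial X = jones_polynomial Y" if "reidemeister_step X Y" for X Y :: "nat pair_pre_digraph"
    using that jones_polynomial_iso jones_polynomial_omega1 jones_polynomial_omega2 jones_polynomial_omega3
    unfolding reidemeister_step_def by blast
  from equiv have "jones_polynomial H = jones_polynomial H'"
    unfolding equivclp_def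
  proof (induction rule: rtranclp_induct)
    case (step Y Z)
    then show ?case using invariant by (auto elim!: symclpE)
  qed simp
  moreover have "digraph_iso (with_proj G') (with_proj H')"
  proof (rule digraph_iso_swap[OF _ H'])
    show "wf_digraph (with_proj H')"
      using H' by (auto simp: digraph_iso_def pre_digraph.digraph_isomorphism_def)
  qed
  note jones_polynomial_iso[OF assms(2) this]
  ultimately show ?thesis using jones_polynomial_iso[OF assms(1) H] by simp
qed

end
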